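(* There exist universal constants $c,C,c_\epsilon>0$ and $d_0\in\mathbb N$ such that, whenever $d\ge d_0$, $R>0$, $0<\mu\le\beta$, $0<\epsilon\le c_\epsilon\beta R^2$, and, with $Q=\beta R^2/\epsilon$ and $\kappa=\beta/\mu$, $$\min\{Q,\kappa\}\le\left(\frac{d}{\log(ed)}\right)^{2/3},$$ one has $$c\,d\sqrt{\min\{Q,\kappa\}}\le N_\epsilon(d,R,\mu,\beta)\le C\,d\sqrt{\min\{Q,\kappa\}}\left[1+\log_+(Q/\kappa)\right].$$
   Context: $B_2^d(r)$ is the closed Euclidean ball of radius $r$ centred at $0$ in $\mathbb R^d$; $X:=B_2^d(R)$. $\log_+(u):=\max\{0,\log u\}$ for $u>0$. Class $\mathcal F_{\mu,\beta}(d,R)$: all continuously differentiable $f:\mathbb R^d\to\mathbb R$ such that for all $x,y\in\mathbb R^d$, $f(y)\ge f(x)+\langle\nabla f(x),y-x\rangle+\frac\mu2\|y-x\|_2^2$ and $\|\nabla f(x)-\nabla f(y)\|_2\le\beta\|x-y\|_2$, and whose unique minimizer $x_f^\star$ lies in $B_2^d(R/2)$. Write $f^\star=f(x_f^\star)$. A deterministic adaptive algorithm with budget $T$ (a $T$-call algorithm) consists of Borel maps $Q_t:(X\times\mathbb R)^{t-1}\to X$, $t=1,\dots,T$, and a Borel terminal map $Q_{\mathrm{out}}:(X\times\mathbb R)^T\to X$. On a fixed objective $f$ it generates recursively $x_t=Q_t((x_1,f(x_1)),\dots,(x_{t-1},f(x_{t-1})))$ and outputs $\widehat x_f=Q_{\mathrm{out}}((x_1,f(x_1)),\dots,(x_T,f(x_T)))$.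 Minimax exact-value complexity: $N_\epsilon(d,R,\mu,\beta)$ is the infimum of all $T\in\mathbb N_0$ for which there exists a deterministic adaptive $T$-call algorithm with $\sup_{f\in\mathcal F_{\mu,\beta}(d,R)}[f(\widehat x_f)-f^\star]\le\epsilon$ (with $\inf\varnothing=+\infty$). *)

theory Defs
  imports "HOL-Analysis.Analysis"
begin

text \<open>
  The dimension is quantified inside the theorem, so \<open>\<real>\<^sup>d\<close> is the carrier of the library's
  \<^const>\<open>Euclidean_space\<close>: functions \<^typ>\<open>nat \<Rightarrow> real\<close> vanishing from index \<open>d\<close> on. The topology
  (and hence the Borel sets) of the type \<^typ>\<open>nat \<Rightarrow> real\<close> is the product topology, which induces
  the usual topology on this carrier. Its library metric is not the Euclidean one, so
  norm and inner product are given explicitly.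
\<close>

definition Rn :: "nat \<Rightarrow> (nat \<Rightarrow> real) set" where
  "Rn d = topspace (Euclidean_space d)"

lemma Rn_iff: "x \<in> Rn d \<longleftrightarrow> (\<forall>i\<ge>d. x i = 0)"
  by (simp add: Rn_def topspace_Euclidean_space)

definition inner_n :: "nat \<Rightarrow> (nat \<Rightarrow> real) \<Rightarrow> (nat \<Rightarrow> real) \<Rightarrow> real" where
  "inner_n d x y = (\<Sum>i<d. x i * y i)"

definition norm_n :: "nat \<Rightarrow> (nat \<Rightarrow> real) \<Rightarrow> real" where
  "norm_n d x = L2_set x {..<d}"

definition cball_n :: "nat \<Rightarrow> real \<Rightarrow> (nat \<Rightarrow> real) set" where
  "cball_n d r = {x \<in> Rn d. norm_n d x \<le> r}"

text \<open>Frechet differentiability on \<open>\<real>\<^sup>d\<close> at \<open>x\<close>, with gradient \<open>g\<close>.\<close>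

definition has_gradient ::
  "nat \<Rightarrow> ((nat \<Rightarrow> real) \<Rightarrow> real) \<Rightarrow> (nat \<Rightarrow> real) \<Rightarrow> (nat \<Rightarrow> real) \<Rightarrow> bool" where
  "has_gradient d f g x \<longleftrightarrow> g \<in> Rn d \<and>
     (\<forall>e>0. \<exists>\<delta>>0. \<forall>y\<in>Rn d. norm_n d (y - x) < \<delta> \<longrightarrow>
        \<bar>f y - f x - inner_n d g (y - x)\<bar> \<le> e * norm_n d (y - x))"

definition is_minimizer :: "nat \<Rightarrow> ((nat \<Rightarrow> real) \<Rightarrow> real) \<Rightarrow> (nat \<Rightarrow> real) \<Rightarrow> bool" where
  "is_minimizer d f x \<longleftrightarrow> is_arg_min f (\<lambda>y. y \<in> Rn d) x"

definition minimizer :: "nat \<Rightarrow> ((nat \<Rightarrow> real) \<Rightarrow> real) \<Rightarrow> nat \<Rightarrow> real" where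
  "minimizer d f = (THE x. is_minimizer d f x)"

text \<open>
  A gradient is unique, so on \<open>\<real>\<^sup>d\<close> the map \<open>G\<close> is \<open>\<nabla>f\<close>. The values of \<open>f\<close> outside
  \<^term>\<open>Rn d\<close> are unconstrained and never used.
\<close>

definition obj_class ::
  "nat \<Rightarrow> real \<Rightarrow> real \<Rightarrow> real \<Rightarrow> ((nat \<Rightarrow> real) \<Rightarrow> real) set" where
  "obj_class d R \<mu> \<beta> = {f.
     (\<exists>G. (\<forall>x\<in>Rn d. has_gradient d f (G x) x) \<and>
          continuous_map (Euclidean_space d) (Euclidean_space d) G \<and>
          (\<forall>x\<in>Rn d. \<forall>y\<in>Rn d.
             f y \<ge> f x + inner_n d (G x) (y - x) + \<mu> / 2 * (norm_n d (y - x))\<^sup>2 \<and>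
             norm_n d (G x - G y) \<le> \<beta> * norm_n d (x - y))) \<and>
     (\<exists>!x. is_minimizer d f x) \<and>
     minimizer d f \<in> cball_n d (R / 2)}"

type_synonym transcript = "nat \<Rightarrow> (nat \<Rightarrow> real) \<times> real"

definition ball_borel :: "nat \<Rightarrow> real \<Rightarrow> (nat \<Rightarrow> real) measure" where
  "ball_borel d R = restrict_space borel (cball_n d R)"

text \<open>
  The space \<open>(X \<times> \<real>)\<^sup>n\<close> with its Borel sets; all factors are second countable, so the
  product \<open>\<sigma>\<close>-algebra is the Borel \<open>\<sigma>\<close>-algebra of the product.
\<close>

definition transcript_space :: "nat \<Rightarrow> real \<Rightarrow> nat \<Rightarrow> transcript measure" where
  "transcript_space d R n = Pi\<^sub>M {..<n} (\<lambda>_. ball_borel d R \<Otimes>\<^sub>M borel)"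

text \<open>
  Queries are numbered from \<open>0\<close>: \<open>q t\<close> chooses a point after \<open>t\<close> observations, \<open>t < T\<close>.
\<close>

definition is_algorithm ::
  "nat \<Rightarrow> real \<Rightarrow> nat \<Rightarrow> (nat \<Rightarrow> transcript \<Rightarrow> nat \<Rightarrow> real) \<Rightarrow> (transcript \<Rightarrow> nat \<Rightarrow> real) \<Rightarrow> bool"
  where
  "is_algorithm d R T q qout \<longleftrightarrow>
     (\<forall>t<T. q t \<in> transcript_space d R t \<rightarrow>\<^sub>M ball_borel d R) \<and>
     qout \<in> transcript_space d R T \<rightarrow>\<^sub>M ball_borel d R"

text \<open>
  \<open>transcript_of q f t\<close> lists the first \<open>t\<close> query-value pairs. Entries from index \<open>t\<close> on are
  \<^term>\<open>undefined\<close>, as membership in the space of \<^const>\<open>Pi\<^sub>M\<close> requires.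
\<close>

primrec transcript_of ::
  "(nat \<Rightarrow> transcript \<Rightarrow> nat \<Rightarrow> real) \<Rightarrow> ((nat \<Rightarrow> real) \<Rightarrow> real) \<Rightarrow> nat \<Rightarrow> transcript" where
  "transcript_of q f 0 = (\<lambda>_. undefined)"
| "transcript_of q f (Suc t) =
     (let x = q t (transcript_of q f t) in (transcript_of q f t)(t := (x, f x)))"

definition alg_output ::
  "nat \<Rightarrow> (nat \<Rightarrow> transcript \<Rightarrow> nat \<Rightarrow> real) \<Rightarrow> (transcript \<Rightarrow> nat \<Rightarrow> real) \<Rightarrow>
     ((nat \<Rightarrow> real) \<Rightarrow> real) \<Rightarrow> nat \<Rightarrow> real" where
  "alg_output T q qout f = qout (transcript_of q f T)"

definition value_complexity :: "real \<Rightarrow> nat \<Rightarrow> real \<Rightarrow> real \<Rightarrow> real \<Rightarrow> enat" where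
  "value_complexity \<epsilon> d R \<mu> \<beta> = Inf {enat T | T. \<exists>q qout. is_algorithm d R T q qout \<and>
     (SUP f\<in>obj_class d R \<mu> \<beta>. ereal (f (alg_output T q qout f) - f (minimizer d f))) \<le> ereal \<epsilon>}"

definition log_plus :: "real \<Rightarrow> real" where
  "log_plus u = max 0 (ln u)"

end

theory Submission
  imports Defs
begin

text \<open>
  Upper bound: since values are exact, forward differences with a tiny step turn \<open>d + 1\<close> values into
  an almost exact gradient, and accelerated projected gradient descent, restarted every
  \<open>O(\<surd>min {Q, \<kappa>})\<close> iterations, needs \<open>O(1 + log\<^sub>+ (Q / \<kappa>))\<close> periods.

  Lower bound: the hard function couples the coordinates along orthonormal vectors
  \<open>v\<^sub>0, \<dots>, v\<^sub>n\<close>, \<open>n \<approx> \<surd>min {Q, \<kappa>}\<close>, in a quadratic chain whose links have dead zones of width about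
  \<open>R n\<^sup>-\<^sup>3\<^sup>/\<^sup>2\<close>. During stage \<open>i\<close>, which lasts for about \<open>d / 4\<close> queries, the
  values do not depend on \<open>v\<^sub>i, v\<^sub>i\<^sub>+\<^sub>1, \<dots>\<close>, and afterwards \<open>v\<^sub>i\<close> is fixed orthogonal to the queries of the stage
  and almost orthogonal to all the earlier ones. Such a vector exists as soon as the dead zones
  exceed \<open>R \<surd>(log d / d)\<close>, which is the hypothesis on \<open>min {Q, \<kappa>}\<close>.
  Half of the chain remains unexplored after \<open>\<Omega>(n d)\<close> queries.
\<close>

subsection \<open>Vectors\<close>

text \<open>A stage of about d / 4 queries imposes only that many linear conditions on
  \<open>v i\<close>, so exact orthogonality can meet them. The whole run has about n d queries,
  which can far exceed the dimension: towards the earlier ones only near-orthogonality is possible,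
  and this is what forces the dead zones. Their width has this origin: n coordinates of size about R
  / sqrt n, decreasing by a constant factor along the chain, make each link of the minimizer about R
  n^(-3/2) long, and a dead zone takes a constant fraction of its link. Requiring n^(-3/2) to exceed
  sqrt (log d / d) means n^3 \<le> d / log d, hence the exponent 2/3 for n^2. Both regimes of the
  minimum are served by one modulus \<nu> = \<beta> / K \<ge> \<mu> with K of order min {Q,
  \<kappa>}. When Q is the smaller one, the hard functions are more strongly convex than the class
  demands, just enough for the gap \<nu> R^2 / 256 to exceed \<epsilon>. In the upper bound the same
  regime is the one in which a single period suffices.\<close>

lemma norm_n_sq: "(norm_n d x)\<^sup>2 = inner_n d x x"
  by (simp add: norm_n_def L2_set_def inner_n_def sum_nonneg power2_eq_square)

lemma norm_n_ge0 [simp]: "0 \<le> norm_n d x"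
  by (simp add: norm_n_def)

lemma inner_n_commute: "inner_n d x y = inner_n d y x"
  by (simp add: inner_n_def mult.commute)

lemma inner_n_ge0 [simp]: "0 \<le> inner_n d x x"
  by (metis norm_n_sq zero_le_power2)

lemma inner_n_zero [simp]: "inner_n d (\<lambda>i. 0) x = 0" "inner_n d x (\<lambda>i. 0) = 0"
  by (simp_all add: inner_n_def)

lemma inner_n_add: "inner_n d (\<lambda>i. x i + y i) z = inner_n d x z + inner_n d y z"
    "inner_n d z (\<lambda>i. x i + y i) = inner_n d z x + inner_n d z y"
  by (simp_all add: inner_n_def sum.distrib algebra_simps)

lemma inner_n_diff: "inner_n d (\<lambda>i. x i - y i) z = inner_n d x z - inner_n d y z"
    "inner_n d z (\<lambda>i. x i - y i) = inner_n d z x - inner_n d z y"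
  by (simp_all add: inner_n_def sum_subtractf algebra_simps)

lemma inner_n_minus: "inner_n d (x - y) z = inner_n d x z - inner_n d y z"
    "inner_n d z (x - y) = inner_n d z x - inner_n d z y"
  by (simp_all add: inner_n_def sum_subtractf algebra_simps)

lemma inner_n_scale: "inner_n d (\<lambda>i. a * x i) z = a * inner_n d x z"
    "inner_n d z (\<lambda>i. a * x i) = a * inner_n d z x"
  by (simp_all add: inner_n_def sum_distrib_left algebra_simps)

lemma inner_n_sum: "inner_n d (\<lambda>i. \<Sum>j\<in>J. X j i) z = (\<Sum>j\<in>J. inner_n d (X j) z)"
    "inner_n d z (\<lambda>i. \<Sum>j\<in>J. X j i) = (\<Sum>j\<in>J. inner_n d z (X j))"
  unfolding inner_n_def
  by (subst sum.swap, simp add: sum_distrib_right sum_distrib_left)+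

lemmas inner_n_linear = inner_n_add inner_n_diff inner_n_minus inner_n_scale inner_n_sum

lemma norm_n_le_iff: "0 \<le> r \<Longrightarrow> norm_n d x \<le> r \<longleftrightarrow> inner_n d x x \<le> r\<^sup>2"
  by (metis norm_n_ge0 norm_n_sq power2_le_imp_le power_mono)

lemma norm_n_eq_sqrt: "norm_n d x = sqrt (inner_n d x x)"
  by (metis norm_n_ge0 norm_n_sq real_sqrt_unique)

lemma inner_n_Cauchy: "\<bar>inner_n d x y\<bar> \<le> norm_n d x * norm_n d y"
proof -
  have "\<bar>inner_n d x y\<bar> \<le> (\<Sum>i<d. \<bar>x i\<bar> * \<bar>y i\<bar>)"
    unfolding inner_n_def by (rule order_trans[OF sum_abs]) (simp add: abs_mult)
  also have "\<dots> \<le> norm_n d x * norm_n d y"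
    unfolding norm_n_def by (rule L2_set_mult_ineq)
  finally show ?thesis .
qed

lemma norm_n_triangle: "norm_n d (x - z) \<le> norm_n d (x - y) + norm_n d (y - z)"
proof -
  have "norm_n d (x - z) = L2_set (\<lambda>i. (x - y) i + (y - z) i) {..<d}"
    by (simp add: norm_n_def L2_set_def)
  also have "\<dots> \<le> norm_n d (x - y) + norm_n d (y - z)"
    unfolding norm_n_def by (rule L2_set_triangle_ineq)
  finally show ?thesis .
qed

lemma norm_n_scale: "norm_n d (\<lambda>i. a * x i) = \<bar>a\<bar> * norm_n d x"
proof -
  have "inner_n d (\<lambda>i. a * x i) (\<lambda>i. a * x i) = a\<^sup>2 * inner_n d x x"
    by (simp add: inner_n_scale power2_eq_square)
  then show ?thesis by (simp add: norm_n_eq_sqrt real_sqrt_mult)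
qed

lemma norm_n_eq_0D: "norm_n d x = 0 \<Longrightarrow> i < d \<Longrightarrow> x i = 0"
  by (simp add: norm_n_def L2_set_eq_0_iff)

lemma norm_n_zero [simp]: "norm_n d (\<lambda>i. 0) = 0"
  by (simp add: norm_n_eq_sqrt)

lemma component_le_norm_n: "i < d \<Longrightarrow> \<bar>x i\<bar> \<le> norm_n d x"
proof -
  assume "i < d"
  then have "(x i)\<^sup>2 \<le> (\<Sum>i<d. (x i)\<^sup>2)"
    by (intro member_le_sum) auto
  then show ?thesis by (simp add: norm_n_def L2_set_def real_le_rsqrt)
qed

lemma cball_n_iff: "x \<in> cball_n d r \<longleftrightarrow> x \<in> Rn d \<and> norm_n d x \<le> r"
  by (simp add: cball_n_def)

lemma Bessel_n:
  fixes n :: nat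
  assumes orth: "\<And>j k. j < n \<Longrightarrow> k < n \<Longrightarrow> inner_n d (e j) (e k) = (if j = k then 1 else 0)"
  shows "(\<Sum>j<n. (inner_n d (e j) x)\<^sup>2) \<le> inner_n d x x"
proof -
  define p where "p = (\<lambda>i. \<Sum>j<n. inner_n d (e j) x * e j i)"
  have 1: "inner_n d p x = (\<Sum>j<n. (inner_n d (e j) x)\<^sup>2)"
    by (simp add: p_def inner_n_linear power2_eq_square)
  have "inner_n d p p = (\<Sum>j<n. inner_n d (e j) x * (\<Sum>k<n. inner_n d (e k) x * inner_n d (e j) (e k)))"
    by (simp add: p_def inner_n_linear sum_distrib_left)
  also have "\<dots> = (\<Sum>j<n. inner_n d (e j) x * (\<Sum>k<n. if k = j then inner_n d (e k) x else 0))"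
    by (intro sum.cong refl arg_cong2[where f = "(*)"]) (auto simp: orth)
  also have "\<dots> = (\<Sum>j<n. (inner_n d (e j) x)\<^sup>2)"
    by (intro sum.cong refl) (subst sum.delta, simp_all add: power2_eq_square)
  finally have 2: "inner_n d p p = (\<Sum>j<n. (inner_n d (e j) x)\<^sup>2)" .
  have "0 \<le> inner_n d (x - p) (x - p)" by simp
  also have "\<dots> = inner_n d x x - inner_n d p x"
    using 1 2 by (simp add: inner_n_minus inner_n_commute[of d x p])
  finally show ?thesis using 1 by simp
qed

text \<open>Gaussian elimination: if the last equation has a nonzero coefficient at
  \<open>p\<close>, it is solved for the unknown \<open>p\<close> and substituted into the others,
  which gives \<open>B\<close>. The map \<open>sk\<close> enumerates the remaining unknowns by
  skipping \<open>p\<close>.\<close>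

lemma underdetermined_system:
  fixes A :: "nat \<Rightarrow> nat \<Rightarrow> real"
  assumes "m < n"
  shows "\<exists>x. (\<exists>i<n. x i \<noteq> 0) \<and> (\<forall>r<m. (\<Sum>i<n. A r i * x i) = 0)"
  using assms
proof (induction m arbitrary: n A)
  case 0
  then show ?case by (intro exI[of _ "\<lambda>i. 1"]) auto
next
  case (Suc m)
  then obtain n' where n: "n = Suc n'" and mn: "m < n'" by (metis Suc_less_eq2)
  show ?case
  proof (cases "\<exists>p<n. A m p \<noteq> 0")
    case False
    obtain x where x: "\<exists>i<n. x i \<noteq> 0" "\<forall>r<m. (\<Sum>i<n. A r i * x i) = 0"
      using Suc.IH[of n A] Suc.prems by auto
    have "\<forall>r<Suc m. (\<Sum>i<n. A r i * x i) = 0"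
      using x(2) False by (auto simp: less_Suc_eq)
    with x(1) show ?thesis by blast
  next
    case True
    then obtain p where p: "p < n" "A m p \<noteq> 0" by blast
    define sk where "sk i = (if i < p then i else Suc i)" for i
    define B where "B r i = A r (sk i) - A r p * A m (sk i) / A m p" for r i
    obtain y where y: "\<exists>i<n'. y i \<noteq> 0" "\<forall>r<m. (\<Sum>i<n'. B r i * y i) = 0"
      using Suc.IH[OF mn, of B] by auto
    define s where "s = (\<Sum>i<n'. A m (sk i) * y i)"
    define x where "x i = (if i < p then y i else if i = p then - s / A m p else y (i - 1))" for i
    have x_sk: "x (sk i) = y i" for i by (auto simp: x_def sk_def)
    have inj: "inj_on sk {..<n'}" by (auto simp: inj_on_def sk_def split: if_splits)
    have im: "{..<n} = insert p (sk ` {..<n'})"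
    proof -
      have "i \<in> insert p (sk ` {..<n'})" if "i < n" for i
      proof (cases i p rule: linorder_cases)
        case less
        then have "i = sk i" "i < n'" using p n by (auto simp: sk_def)
        then show ?thesis by blast
      next
        case greater
        then have "i = sk (i - 1)" "i - 1 < n'" using that n by (auto simp: sk_def)
        then show ?thesis by blast
      qed auto
      moreover have "sk i < n" if "i < n'" for i using that n by (simp add: sk_def)
      ultimately show ?thesis using p by blast
    qed
    have "sk i \<noteq> p" for i by (simp add: sk_def)
    then have pn: "p \<notin> sk ` {..<n'}" by (metis imageE)
    have expand: "(\<Sum>i<n. A r i * x i) = A r p * x p + (\<Sum>i<n'. A r (sk i) * y i)" for r
      unfolding im using pn inj by (simp add: sum.reindex x_sk)
    have xp: "x p = - s / A m p" by (simp add: x_def)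
    have "(\<Sum>i<n. A r i * x i) = 0" if "r < Suc m" for r
    proof (cases "r = m")
      case True
      then show ?thesis using expand[of m] p xp by (simp add: s_def)
    next
      case False
      then have "(\<Sum>i<n'. B r i * y i) = 0" using y that by auto
      moreover have "(\<Sum>i<n'. B r i * y i) = (\<Sum>i<n'. A r (sk i) * y i) - A r p / A m p * s"
        unfolding B_def s_def left_diff_distrib sum_subtractf sum_distrib_left
        by (simp add: mult_ac)
      ultimately show ?thesis using expand[of r] xp by simp
    qed
    moreover have "\<exists>i<n. x i \<noteq> 0"
    proof -
      obtain i where "i < n'" "y i \<noteq> 0" using y by blast
      then have "sk i < n" "x (sk i) \<noteq> 0" using im x_sk by auto
      then show ?thesis by blast
    qed
    ultimately show ?thesis by blast
  qed
qed

lemma exists_unit_orthogonal: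
  assumes "finite W" "card W < d"
  shows "\<exists>v\<in>Rn d. inner_n d v v = 1 \<and> (\<forall>w\<in>W. inner_n d v w = 0)"
proof -
  obtain w where w: "bij_betw w {0..<card W} W"
    using ex_bij_betw_nat_finite[OF assms(1)] by blast
  obtain x where x: "\<exists>i<d. x i \<noteq> 0" "\<forall>r<card W. (\<Sum>i<d. w r i * x i) = 0"
    using underdetermined_system[OF assms(2), of w] by blast
  define y where "y i = (if i < d then x i else 0)" for i
  have yx: "inner_n d y z = inner_n d x z" "inner_n d z y = inner_n d z x" for z
    by (simp_all add: inner_n_def y_def)
  have "norm_n d x \<noteq> 0" using x(1) norm_n_eq_0D by blast
  then have N: "norm_n d x > 0" using norm_n_ge0[of d x] by linarith
  define v where "v i = 1 / norm_n d x * y i" for i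
  have "v \<in> Rn d" by (simp add: Rn_iff v_def y_def)
  moreover have "inner_n d v v = 1"
    unfolding v_def inner_n_scale yx using N by (simp add: norm_n_sq[symmetric] power2_eq_square)
  moreover have "inner_n d v z = 0" if "z \<in> W" for z
  proof -
    have "z \<in> w ` {0..<card W}" using that by (simp only: bij_betw_imp_surj_on[OF w])
    then obtain r where "r < card W" "z = w r" by auto
    then have "inner_n d x z = 0" using x(2) by (simp add: inner_n_def mult.commute)
    then show ?thesis unfolding v_def inner_n_scale yx by simp
  qed
  ultimately show ?thesis by blast
qed

text \<open>Greedy: the vectors already found join \<open>W\<close>, and the next one exists as long
  as there are fewer than \<open>d\<close> constraints.\<close>

lemma exists_orthonormal_family:
  assumes "finite W" "card W + n \<le> d"
  shows "\<exists>e. (\<forall>j<n. e j \<in> Rn d \<and> (\<forall>w\<in>W. inner_n d (e j) w = 0)) \<and>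
    (\<forall>j<n. \<forall>k<n. inner_n d (e j) (e k) = (if j = k then 1 else 0))"
  using assms(2)
proof (induction n)
  case (Suc n)
  from Suc.prems have "card W + n \<le> d" by simp
  from Suc.IH[OF this] obtain e where e: "\<And>j. j < n \<Longrightarrow> e j \<in> Rn d"
      "\<And>j w. j < n \<Longrightarrow> w \<in> W \<Longrightarrow> inner_n d (e j) w = 0"
      "\<And>j k. j < n \<Longrightarrow> k < n \<Longrightarrow> inner_n d (e j) (e k) = (if j = k then 1 else 0)"
    by metis
  have "card (W \<union> e ` {..<n}) \<le> card W + n"
    by (metis card_Un_le card_image_le card_lessThan finite_lessThan add_left_mono order_trans)
  then obtain v where v: "v \<in> Rn d" "inner_n d v v = 1" "\<forall>w\<in>W \<union> e ` {..<n}. inner_n d v w = 0"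
    using exists_unit_orthogonal[of "W \<union> e ` {..<n}" d] assms(1) Suc.prems by auto
  have ve: "j < n \<Longrightarrow> inner_n d v (e j) = 0 \<and> inner_n d (e j) v = 0" for j
    using v(3) by (auto simp: inner_n_commute)
  show ?case
    by (rule exI[of _ "e(n := v)"]) (use v e ve in \<open>auto simp: less_Suc_eq\<close>)
qed simp

subsection \<open>Almost orthogonal unit vectors\<close>

text \<open>Termwise comparison of the two power series in x^2, by 2^n n! \<le> (2n)!. This is the
  moment bound of a random sign, the source of all sub-Gaussian estimates here.\<close>

lemma cosh_le_exp_half_sq: "cosh (x::real) \<le> exp (x\<^sup>2 / 2)"
proof -
  have fact_ge: "2 ^ n * fact n \<le> (fact (2 * n) :: real)" for n
  proof (induction n)
    case (Suc n)
    have f: "fact (2 * Suc n) = (2 * real (Suc n)) * (real (2 * n + 1) * fact (2 * n))"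
    proof -
      have "2 * Suc n = Suc (Suc (2 * n))" by simp
      then have "fact (2 * Suc n) = (fact (Suc (Suc (2 * n))) :: real)" by (simp only:)
      also have "\<dots> = real (Suc (Suc (2 * n))) * (real (Suc (2 * n)) * fact (2 * n))" by (simp only: fact_Suc)
      also have "\<dots> = (2 * real (Suc n)) * (real (2 * n + 1) * fact (2 * n))" by (simp only: of_nat_Suc of_nat_mult of_nat_add) (simp add: algebra_simps)
      finally show ?thesis .
    qed
    have "2 ^ Suc n * fact (Suc n) = (2 * real (Suc n)) * (2 ^ n * fact n)"
      by (simp add: mult_ac del: of_nat_Suc)
    also have "\<dots> \<le> (2 * real (Suc n)) * (real (2 * n + 1) * fact (2 * n))"
    proof (intro mult_left_mono)
      have "2 ^ n * fact n \<le> 1 * (fact (2 * n) :: real)" using Suc by simp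
      also have "\<dots> \<le> real (2 * n + 1) * fact (2 * n)" by (intro mult_right_mono) auto
      finally show "2 ^ n * fact n \<le> real (2 * n + 1) * fact (2 * n)" .
    qed auto
    finally show ?case unfolding f .
  qed simp
  have "(\<lambda>n. if even (2 * n) then x ^ (2 * n) /\<^sub>R fact (2 * n) else 0) sums cosh x"
  proof (subst sums_mono_reindex[of "\<lambda>n. 2 * n" "\<lambda>n. if even n then x ^ n /\<^sub>R fact n else 0"])
    show "(if even n then x ^ n /\<^sub>R fact n else 0) = 0" if "n \<notin> range (\<lambda>n. 2 * n)" for n
      using that by (metis dvd_def rangeI)
  qed (use cosh_converges[of x] in \<open>auto simp: strict_mono_def\<close>)
  then have a: "(\<lambda>n. x ^ (2 * n) /\<^sub>R fact (2 * n)) sums cosh x" by simp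
  have b: "(\<lambda>n. (x\<^sup>2 / 2) ^ n /\<^sub>R fact n) sums exp (x\<^sup>2 / 2)"
    by (rule exp_converges)
  have c: "x ^ (2 * n) /\<^sub>R fact (2 * n) \<le> (x\<^sup>2 / 2) ^ n /\<^sub>R fact n" for n
  proof -
    have "(x\<^sup>2) ^ n / fact (2 * n) \<le> (x\<^sup>2) ^ n / (2 ^ n * fact n)"
      using fact_ge[of n] by (intro divide_left_mono) auto
    also have "(x\<^sup>2) ^ n / fact (2 * n) = x ^ (2 * n) /\<^sub>R fact (2 * n)"
      unfolding power_mult[of x 2 n] real_scaleR_def by (simp only: divide_inverse mult.commute)
    also have "(x\<^sup>2) ^ n / (2 ^ n * fact n) = (x\<^sup>2 / 2) ^ n /\<^sub>R fact n"
      by (simp only: power_divide real_scaleR_def) (simp only: divide_inverse inverse_mult_distrib mult_ac)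
    finally show ?thesis .
  qed
  show ?thesis by (rule sums_le[OF c a b])
qed

text \<open>The signs are chosen greedily: one of the two choices for the next sign does not
  increase the potential, since \<open>cosh (u + v) + cosh (u - v) = 2 cosh u cosh v\<close>.\<close>

lemma balancing_signs:
  fixes a :: "'p \<Rightarrow> nat \<Rightarrow> real"
  assumes "finite P"
  shows "\<exists>s. (\<forall>j. \<bar>s j\<bar> = (1::real)) \<and>
    (\<Sum>p\<in>P. cosh (\<Sum>j<n. s j * a p j) * exp (- (\<Sum>j<n. (a p j)\<^sup>2 / 2))) \<le> card P"
proof (induction n)
  case 0
  then show ?case by (intro exI[of _ "\<lambda>j. 1"]) simp
next
  case (Suc n)
  then obtain s where s: "\<And>j. \<bar>s j\<bar> = (1::real)" and
    le: "(\<Sum>p\<in>P. cosh (\<Sum>j<n. s j * a p j) * exp (- (\<Sum>j<n. (a p j)\<^sup>2 / 2))) \<le> card P"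
    by blast
  define A where "A p = (\<Sum>j<n. s j * a p j)" for p
  define B where "B p = (\<Sum>j<n. (a p j)\<^sup>2 / 2)" for p
  define \<Phi> where "\<Phi> \<sigma> = (\<Sum>p\<in>P. cosh (A p + \<sigma> * a p n) * exp (- (B p + (a p n)\<^sup>2 / 2)))" for \<sigma>
  have "\<Phi> 1 + \<Phi> (- 1) = (\<Sum>p\<in>P. 2 * cosh (A p) * cosh (a p n) * exp (- (B p + (a p n)\<^sup>2 / 2)))"
    unfolding \<Phi>_def sum.distrib[symmetric]
    by (intro sum.cong) (auto simp: cosh_add cosh_diff algebra_simps)
  also have "\<dots> \<le> (\<Sum>p\<in>P. 2 * cosh (A p) * exp ((a p n)\<^sup>2 / 2) * exp (- (B p + (a p n)\<^sup>2 / 2)))"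
    by (intro sum_mono mult_right_mono mult_left_mono cosh_le_exp_half_sq) auto
  also have "\<dots> = (\<Sum>p\<in>P. 2 * (cosh (A p) * exp (- B p)))"
    by (intro sum.cong) (auto simp: mult.assoc exp_add[symmetric])
  also have "\<dots> = 2 * (\<Sum>p\<in>P. cosh (A p) * exp (- B p))" by (simp add: sum_distrib_left)
  also have "\<dots> \<le> 2 * card P" using le by (simp add: A_def B_def)
  finally have "\<Phi> 1 \<le> card P \<or> \<Phi> (- 1) \<le> card P" by linarith
  then obtain \<sigma> where \<sigma>: "\<bar>\<sigma>\<bar> = 1" "\<Phi> \<sigma> \<le> card P" by (metis abs_minus abs_one)
  have "(\<Sum>j<n. (s(n := \<sigma>)) j * a p j) = A p" for p
    unfolding A_def by (intro sum.cong) auto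
  then have "(\<Sum>p\<in>P. cosh (\<Sum>j<Suc n. (s(n := \<sigma>)) j * a p j) * exp (- (\<Sum>j<Suc n. (a p j)\<^sup>2 / 2))) = \<Phi> \<sigma>"
    by (simp add: \<Phi>_def B_def)
  then show ?case using \<sigma> s by (intro exI[of _ "s(n := \<sigma>)"]) auto
qed

text \<open>The Chernoff step: cosh dominates half of the exponential of the absolute value. The
  choice of \<open>l\<close> makes \<open>l\<^sup>2 * r\<^sup>2 / 2\<close> equal to
  \<open>ln (2 * M)\<close>, which balances the two contributions.\<close>

lemma abs_le_of_cosh:
  fixes t :: real
  assumes "cosh (l * t) \<le> M * exp (l\<^sup>2 * r\<^sup>2 / 2)" "r > 0" "M > 1 / 2"
    "l = sqrt (2 * ln (2 * M)) / r"
  shows "\<bar>t\<bar> \<le> r * sqrt (2 * ln (2 * M))"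
proof -
  define q where "q = sqrt (2 * ln (2 * M))"
  have q: "q > 0" "q\<^sup>2 = 2 * ln (2 * M)" using assms by (simp_all add: q_def)
  have l: "l = q / r" "l > 0" using assms q by (simp_all add: q_def)
  have "exp (l * \<bar>t\<bar>) / 2 \<le> cosh (l * \<bar>t\<bar>)"
    by (simp add: cosh_field_def divide_right_mono)
  also have "\<dots> = cosh (l * t)" by (cases "t \<ge> 0") auto
  also have "\<dots> \<le> M * exp (q\<^sup>2 / 2)" using assms(1,2) l by (simp add: power_divide)
  finally have "exp (l * \<bar>t\<bar>) \<le> exp (ln (2 * M)) * exp (q\<^sup>2 / 2)"
    using assms(3) by simp
  then have "l * \<bar>t\<bar> \<le> ln (2 * M) + q\<^sup>2 / 2" by (simp add: exp_add[symmetric])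
  also have "\<dots> = q * q" using q by (simp add: power2_eq_square)
  finally have "q * \<bar>t\<bar> \<le> q * (r * q)" using l assms(2) by (simp add: field_simps)
  then show ?thesis using q by (simp add: q_def)
qed

text \<open>A derandomized random vector: \<open>v\<close> is the normalized signed sum of
  \<open>n\<close> orthonormal vectors orthogonal to \<open>W\<close>, with the signs of
  \<open>balancing_signs\<close>. By Bessel the coefficients of \<open>x\<close> have square sum at
  most \<open>r\<^sup>2\<close>, so the signed sum is of order r sqrt (log M), and normalization
  divides by sqrt n. Here \<open>n\<close> is the room left besides \<open>W\<close>, while the size
  of \<open>P\<close> enters only through a logarithm.\<close>

lemma exists_almost_orthogonal:
  assumes "finite W" "card W + n \<le> d" "0 < n" "finite P" "card P \<le> M" "1 \<le> M" "0 < r"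
    "\<And>x. x \<in> P \<Longrightarrow> norm_n d x \<le> r"
  shows "\<exists>v\<in>Rn d. inner_n d v v = 1 \<and> (\<forall>w\<in>W. inner_n d v w = 0) \<and>
    (\<forall>x\<in>P. \<bar>inner_n d v x\<bar> \<le> r * sqrt (2 * ln (2 * real M) / real n))"
proof -
  obtain e where e: "\<And>j. j < n \<Longrightarrow> e j \<in> Rn d"
      "\<And>j w. j < n \<Longrightarrow> w \<in> W \<Longrightarrow> inner_n d (e j) w = 0"
      "\<And>j k. j < n \<Longrightarrow> k < n \<Longrightarrow> inner_n d (e j) (e k) = (if j = k then 1 else 0)"
    using exists_orthonormal_family[OF assms(1,2)] by blast
  define l where "l = sqrt (2 * ln (2 * real M)) / r"
  obtain s where s: "\<And>j. \<bar>s j\<bar> = (1::real)" and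
    le: "(\<Sum>p\<in>P. cosh (\<Sum>j<n. s j * (l * inner_n d (e j) p)) *
      exp (- (\<Sum>j<n. (l * inner_n d (e j) p)\<^sup>2 / 2))) \<le> card P"
    using balancing_signs[OF assms(4), of "\<lambda>p j. l * inner_n d (e j) p" n] by blast
  define u where "u i = (\<Sum>j<n. s j * e j i)" for i
  define v where "v i = 1 / sqrt n * u i" for i
  have u: "inner_n d u x = (\<Sum>j<n. s j * inner_n d (e j) x)" for x
    unfolding u_def by (simp add: inner_n_linear)
  have u2: "inner_n d x u = (\<Sum>j<n. s j * inner_n d x (e j))" for x
    unfolding u_def by (simp add: inner_n_linear)
  have v: "inner_n d v x = inner_n d u x / sqrt n" for x
    unfolding v_def inner_n_scale by simp
  have "inner_n d u u = (\<Sum>j<n. s j * (\<Sum>k<n. s k * inner_n d (e j) (e k)))"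
    unfolding u by (subst u2) simp
  also have "\<dots> = (\<Sum>j<n. s j * (\<Sum>k<n. if k = j then s k else 0))"
    by (intro sum.cong refl arg_cong2[where f = "(*)"]) (auto simp: e(3))
  also have "\<dots> = (\<Sum>j<n. \<bar>s j\<bar> * \<bar>s j\<bar>)"
    by (intro sum.cong refl) (simp add: abs_mult_self_eq)
  also have "\<dots> = n" by (simp add: s)
  finally have uu: "inner_n d u u = n" .
  have "v \<in> Rn d" using e(1) by (auto simp: Rn_iff v_def u_def)
  moreover have "inner_n d v v = 1"
    unfolding v_def inner_n_scale using assms(3) uu by simp
  moreover have "\<forall>w\<in>W. inner_n d v w = 0" by (simp add: v u e(2))
  moreover have "\<bar>inner_n d v x\<bar> \<le> r * sqrt (2 * ln (2 * real M) / real n)" if x: "x \<in> P" for x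
  proof -
    define b where "b = (\<Sum>j<n. (l * inner_n d (e j) x)\<^sup>2 / 2)"
    \<comment> \<open>A single term of a sum of positive terms is bounded by the whole sum, which is
      at most \<open>card P\<close>.\<close>
    have "cosh (l * inner_n d u x) * exp (- b) \<le>
      (\<Sum>p\<in>P. cosh (\<Sum>j<n. s j * (l * inner_n d (e j) p)) *
      exp (- (\<Sum>j<n. (l * inner_n d (e j) p)\<^sup>2 / 2)))"
      using member_le_sum[OF x, of "\<lambda>p. cosh (\<Sum>j<n. s j * (l * inner_n d (e j) p)) *
      exp (- (\<Sum>j<n. (l * inner_n d (e j) p)\<^sup>2 / 2))"] assms(4)
      by (simp add: u b_def sum_distrib_left mult_ac)
    also have "\<dots> \<le> M" using le assms(5) by linarith
    finally have 1: "cosh (l * inner_n d u x) \<le> M * exp b"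
      by (simp add: exp_minus field_simps)
    have "b = l\<^sup>2 / 2 * (\<Sum>j<n. (inner_n d (e j) x)\<^sup>2)"
      by (simp add: b_def sum_distrib_left power_mult_distrib)
    also have "\<dots> \<le> l\<^sup>2 / 2 * inner_n d x x"
      using Bessel_n[of n d e x] e(3) by (intro mult_left_mono) auto
    also have "\<dots> \<le> l\<^sup>2 / 2 * r\<^sup>2"
      using assms(7) assms(8)[OF x] by (intro mult_left_mono) (auto simp: norm_n_le_iff[symmetric])
    finally have "M * exp b \<le> M * exp (l\<^sup>2 * r\<^sup>2 / 2)" by (intro mult_left_mono) auto
    with 1 have "cosh (l * inner_n d u x) \<le> M * exp (l\<^sup>2 * r\<^sup>2 / 2)" by linarith
    then have "\<bar>inner_n d u x\<bar> \<le> r * sqrt (2 * ln (2 * real M))"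
      using assms(6) by (intro abs_le_of_cosh[OF _ assms(7) _ l_def]) auto
    then show ?thesis using assms(3) by (simp add: v real_sqrt_divide divide_right_mono)
  qed
  ultimately show ?thesis by blast
qed

subsection \<open>Membership in the objective class\<close>

text \<open>The topology is the product topology, so continuity is checked per coordinate, where the
  Euclidean norm dominates; coordinates from \<open>d\<close> on vanish.\<close>

lemma continuous_map_of_Lipschitz:
  assumes Rn: "\<And>x. x \<in> Rn d \<Longrightarrow> G x \<in> Rn d"
    and lip: "\<And>x y. x \<in> Rn d \<Longrightarrow> y \<in> Rn d \<Longrightarrow> norm_n d (G x - G y) \<le> \<beta> * norm_n d (x - y)"
  shows "continuous_map (Euclidean_space d) (Euclidean_space d) G"
proof -
  have "continuous_on (Rn d) (\<lambda>x. G x i)" for i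
    unfolding continuous_on_def
  proof
    fix x assume x: "x \<in> Rn d"
    have coord: "((\<lambda>y::nat \<Rightarrow> real. y j) \<longlongrightarrow> x j) (at x within Rn d)" for j
      using continuous_on_subset[OF continuous_on_product_coordinates[of j], of "Rn d"] x
      by (auto simp: continuous_on_def)
    have "((\<lambda>y. \<beta> * sqrt (\<Sum>j<d. (x j - y j)\<^sup>2)) \<longlongrightarrow> \<beta> * sqrt (\<Sum>j<d. (x j - x j)\<^sup>2)) (at x within Rn d)"
      by (intro tendsto_intros coord)
    then have lim: "((\<lambda>y. \<beta> * norm_n d (x - y)) \<longlongrightarrow> 0) (at x within Rn d)"
      by (simp add: norm_n_def L2_set_def)
    have "((\<lambda>y. G x i - G y i) \<longlongrightarrow> 0) (at x within Rn d)"
    proof (rule Lim_null_comparison[OF _ lim])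
      have "norm (G x i - G y i) \<le> \<beta> * norm_n d (x - y)" if y: "y \<in> Rn d" for y
      proof (cases "i < d")
        case True
        then have "\<bar>(G x - G y) i\<bar> \<le> norm_n d (G x - G y)" by (rule component_le_norm_n)
        also have "\<dots> \<le> \<beta> * norm_n d (x - y)" by (rule lip[OF x y])
        finally show ?thesis by simp
      next
        case False
        then have "G x i - G y i = 0" using Rn[OF x] Rn[OF y] by (simp add: Rn_iff)
        moreover have "0 \<le> \<beta> * norm_n d (x - y)" using lip[OF x y] norm_n_ge0 order_trans by blast
        ultimately show ?thesis by simp
      qed
      then show "\<forall>\<^sub>F y in at x within Rn d. norm (G x i - G y i) \<le> \<beta> * norm_n d (x - y)"
        by (auto simp: eventually_at_filter)
    qed
    from tendsto_diff[OF tendsto_const[of "G x i"] this]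
    show "((\<lambda>y. G y i) \<longlongrightarrow> G x i) (at x within Rn d)" by simp
  qed
  then have "continuous_on (Rn d) G"
    by (rule continuous_on_coordinatewise_then_product)
  then show ?thesis
    using cm_Euclidean_space_iff_continuous_on[of d UNIV d G] Rn by (auto simp: Rn_def)
qed

text \<open>Convexity at \<open>y\<close> plus Cauchy-Schwarz replace the integral along the
  segment. The price is \<open>\<beta>\<close> in place of half of it, which only affects absolute
  constants.\<close>

lemma smooth_upper_bound:
  assumes conv: "\<And>x y. x \<in> Rn d \<Longrightarrow> y \<in> Rn d \<Longrightarrow> f y \<ge> f x + inner_n d (G x) (y - x)"
    and lip: "\<And>x y. x \<in> Rn d \<Longrightarrow> y \<in> Rn d \<Longrightarrow> norm_n d (G x - G y) \<le> \<beta> * norm_n d (x - y)"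
    and x: "x \<in> Rn d" and y: "y \<in> Rn d"
  shows "f y \<le> f x + inner_n d (G x) (y - x) + \<beta> * (norm_n d (y - x))\<^sup>2"
proof -
  have "f y \<le> f x - inner_n d (G y) (x - y)" using conv[OF y x] by simp
  moreover have "inner_n d (G y) (x - y) = - inner_n d (G x) (y - x) - inner_n d (G y - G x) (y - x)"
    by (simp add: inner_n_minus)
  moreover have "inner_n d (G y - G x) (y - x) \<le> norm_n d (G y - G x) * norm_n d (y - x)"
    using inner_n_Cauchy[of d "G y - G x" "y - x"] by linarith
  moreover have "norm_n d (G y - G x) * norm_n d (y - x) \<le> \<beta> * norm_n d (y - x) * norm_n d (y - x)"
    by (intro mult_right_mono lip x y) auto
  ultimately show ?thesis by (simp add: power2_eq_square)
qed

text \<open>Convexity bounds the remainder from below and \<open>smooth_upper_bound\<close> from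
  above, so a candidate gradient needs two inequalities and no differentiation.\<close>

lemma has_gradientI:
  assumes Rn: "\<And>x. x \<in> Rn d \<Longrightarrow> G x \<in> Rn d"
    and conv: "\<And>x y. x \<in> Rn d \<Longrightarrow> y \<in> Rn d \<Longrightarrow> f y \<ge> f x + inner_n d (G x) (y - x)"
    and lip: "\<And>x y. x \<in> Rn d \<Longrightarrow> y \<in> Rn d \<Longrightarrow> norm_n d (G x - G y) \<le> \<beta> * norm_n d (x - y)"
    and x: "x \<in> Rn d" and "\<beta> > 0"
  shows "has_gradient d f (G x) x"
  unfolding has_gradient_def
proof (intro conjI allI impI)
  fix e :: real assume e: "e > 0"
  show "\<exists>\<delta>>0. \<forall>y\<in>Rn d. norm_n d (y - x) < \<delta> \<longrightarrow>
        \<bar>f y - f x - inner_n d (G x) (y - x)\<bar> \<le> e * norm_n d (y - x)"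
  proof (intro exI[of _ "e / \<beta>"] conjI ballI impI)
    fix y assume y: "y \<in> Rn d" and *: "norm_n d (y - x) < e / \<beta>"
    have "\<bar>f y - f x - inner_n d (G x) (y - x)\<bar> \<le> \<beta> * norm_n d (y - x) * norm_n d (y - x)"
      using smooth_upper_bound[of d f G \<beta>, OF conv lip x y] conv[OF x y]
      by (simp add: power2_eq_square)
    also have "\<dots> \<le> e * norm_n d (y - x)"
      using * \<open>\<beta> > 0\<close> by (intro mult_right_mono) (auto simp: field_simps)
    finally show "\<bar>f y - f x - inner_n d (G x) (y - x)\<bar> \<le> e * norm_n d (y - x)" .
  qed (use e \<open>\<beta> > 0\<close> in simp)
qed (rule Rn[OF x])

lemma minimizer_unique:
  assumes "\<mu> > 0" "u \<in> Rn d"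
    "\<And>y. y \<in> Rn d \<Longrightarrow> f y \<ge> f u + \<mu> / 2 * (norm_n d (y - u))\<^sup>2"
  shows "is_minimizer d f x \<longleftrightarrow> x = u"
proof
  assume "is_minimizer d f x"
  then have x: "x \<in> Rn d" "f x \<le> f u"
    using assms(2) by (auto simp: is_minimizer_def is_arg_min_def not_less)
  then have "\<mu> / 2 * (norm_n d (x - u))\<^sup>2 \<le> 0" using assms(3)[OF x(1)] by linarith
  then have "norm_n d (x - u) = 0" using assms(1) by (simp add: mult_le_0_iff)
  then have "(x - u) i = 0" if "i < d" for i using norm_n_eq_0D that by blast
  moreover have "x i = u i" if "i \<ge> d" for i using that x(1) assms(2) by (simp add: Rn_iff)
  ultimately show "x = u" by (metis ext eq_iff_diff_eq_0 minus_apply not_le)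
next
  assume "x = u"
  moreover have "f u \<le> f y" if "y \<in> Rn d" for y
    using assms(3)[OF that] assms(1) by (smt (verit) mult_nonneg_nonneg divide_nonneg_nonneg zero_le_power2)
  ultimately show "is_minimizer d f x"
    using assms(2) by (auto simp: is_minimizer_def is_arg_min_def not_less)
qed

text \<open>The separate modulus \<open>\<nu>\<close> admits functions more strongly convex than the
  class asks for, which the hard functions are in the regime where Q is the smaller
  parameter.\<close>

lemma obj_classI:
  assumes Rn: "\<And>x. x \<in> Rn d \<Longrightarrow> G x \<in> Rn d"
    and conv: "\<And>x y. x \<in> Rn d \<Longrightarrow> y \<in> Rn d \<Longrightarrow>
      f y \<ge> f x + inner_n d (G x) (y - x) + \<nu> / 2 * (norm_n d (y - x))\<^sup>2"
    and lip: "\<And>x y. x \<in> Rn d \<Longrightarrow> y \<in> Rn d \<Longrightarrow> norm_n d (G x - G y) \<le> \<beta> * norm_n d (x - y)"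
    and u: "u \<in> Rn d" "\<And>y. inner_n d (G u) y = 0" "norm_n d u \<le> R / 2"
    and mu: "0 < \<mu>" "\<mu> \<le> \<nu>" and "\<beta> > 0"
  shows "f \<in> obj_class d R \<mu> \<beta>" "minimizer d f = u"
proof -
  have conv': "f y \<ge> f x + inner_n d (G x) (y - x) + \<mu> / 2 * (norm_n d (y - x))\<^sup>2"
    if "x \<in> Rn d" "y \<in> Rn d" for x y
  proof -
    have "\<mu> / 2 * (norm_n d (y - x))\<^sup>2 \<le> \<nu> / 2 * (norm_n d (y - x))\<^sup>2"
      using mu by (intro mult_right_mono) auto
    with conv[OF that] show ?thesis by linarith
  qed
  have conv0: "f y \<ge> f x + inner_n d (G x) (y - x)" if "x \<in> Rn d" "y \<in> Rn d" for x y
  proof -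
    have "0 \<le> \<mu> / 2 * (norm_n d (y - x))\<^sup>2" using mu by simp
    with conv'[OF that] show ?thesis by linarith
  qed
  have m: "is_minimizer d f x \<longleftrightarrow> x = u" for x
    using conv'[OF u(1)] by (intro minimizer_unique[OF mu(1) u(1)]) (simp add: u(2))
  then show min: "minimizer d f = u" unfolding minimizer_def by (intro the_equality) simp_all
  have "\<forall>x\<in>Rn d. has_gradient d f (G x) x"
    using has_gradientI[of d G f \<beta>, OF Rn conv0 lip _ \<open>\<beta> > 0\<close>] by blast
  moreover have "continuous_map (Euclidean_space d) (Euclidean_space d) G"
    by (rule continuous_map_of_Lipschitz[OF Rn lip])
  moreover have "\<exists>!x. is_minimizer d f x" by (simp add: m)
  moreover have "minimizer d f \<in> cball_n d (R / 2)" using u by (simp add: min cball_n_iff)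
  ultimately show "f \<in> obj_class d R \<mu> \<beta>"
    unfolding obj_class_def using conv' lip by blast
qed

subsection \<open>The hard functions\<close>

text \<open>\<open>phi c\<close> is half the squared distance to \<open>[- c, c]\<close> and \<open>dz c\<close> is its derivative.\<close>

definition dz :: "real \<Rightarrow> real \<Rightarrow> real" where
  "dz c z = z - max (- c) (min c z)"

definition phi :: "real \<Rightarrow> real \<Rightarrow> real" where
  "phi c z = (dz c z)\<^sup>2 / 2"

lemma phi_eq_0: "\<bar>z\<bar> \<le> c \<Longrightarrow> phi c z = 0"
  by (auto simp: phi_def dz_def)

lemma dz_above: "0 \<le> c \<Longrightarrow> c \<le> z \<Longrightarrow> dz c z = z - c"
  by (auto simp: dz_def)

lemma dz_nonexpansive: "\<bar>dz c x - dz c y\<bar> \<le> \<bar>x - y\<bar>"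
  by (auto simp: dz_def max_def min_def abs_if)

lemma phi_convex:
  assumes "0 \<le> c"
  shows "phi c y \<ge> phi c x + dz c x * (y - x)"
proof -
  let ?p = "\<lambda>z. max (- c) (min c z)"
  \<comment> \<open>\<open>?p\<close> is the projection to the interval and \<open>dz c x\<close>
    the outward normal at \<open>?p x\<close>, so this is the obtuse angle property in dimension
    one.\<close>
  have "0 \<le> dz c x * (?p x - ?p y)"
    using assms by (cases "x > c"; cases "x < - c") (auto simp: dz_def intro: mult_nonneg_nonneg mult_nonpos_nonpos)
  moreover have "dz c y - dz c x = (y - x) + (?p x - ?p y)" by (simp add: dz_def)
  ultimately have "dz c x * (y - x) \<le> dz c x * (dz c y - dz c x)"
    by (simp add: distrib_left)
  moreover have "0 \<le> (dz c y - dz c x)\<^sup>2" by simp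
  ultimately show ?thesis by (simp add: phi_def power2_eq_square algebra_simps)
qed

text \<open>Nesterov's worst-case chain in the directions \<open>v j\<close>, with every squared
  link replaced by \<open>phi\<close>. The linear term pulls at \<open>v 0\<close> only, so progress
  has to travel along the links. The width \<open>c j\<close> may differ from link to link, which
  makes it possible to prescribe the minimizer.\<close>

definition hard_fun ::
  "nat \<Rightarrow> real \<Rightarrow> real \<Rightarrow> real \<Rightarrow> (nat \<Rightarrow> real) \<Rightarrow> nat \<Rightarrow> (nat \<Rightarrow> nat \<Rightarrow> real) \<Rightarrow> (nat \<Rightarrow> real) \<Rightarrow> real" where
  "hard_fun d \<mu> b a c n v x = \<mu> / 2 * inner_n d x x - b * inner_n d (v 0) x +
     a * (\<Sum>j<n. phi (c j) (inner_n d (v j) x - inner_n d (v (Suc j)) x))"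

definition hard_grad ::
  "nat \<Rightarrow> real \<Rightarrow> real \<Rightarrow> real \<Rightarrow> (nat \<Rightarrow> real) \<Rightarrow> nat \<Rightarrow> (nat \<Rightarrow> nat \<Rightarrow> real) \<Rightarrow> (nat \<Rightarrow> real) \<Rightarrow> nat \<Rightarrow> real" where
  "hard_grad d \<mu> b a c n v x = (\<lambda>i. \<mu> * x i - b * v 0 i +
     a * (\<Sum>j<n. dz (c j) (inner_n d (v j) x - inner_n d (v (Suc j)) x) * (v j i - v (Suc j) i)))"

definition orthonormal_n :: "nat \<Rightarrow> nat \<Rightarrow> (nat \<Rightarrow> nat \<Rightarrow> real) \<Rightarrow> bool" where
  "orthonormal_n d n v \<longleftrightarrow> (\<forall>j<n. v j \<in> Rn d) \<and>
     (\<forall>j<n. \<forall>k<n. inner_n d (v j) (v k) = (if j = k then 1 else 0))"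

lemma inner_hard_grad:
  "inner_n d (hard_grad d \<mu> b a c n v x) w = \<mu> * inner_n d x w - b * inner_n d (v 0) w +
     a * (\<Sum>j<n. dz (c j) (inner_n d (v j) x - inner_n d (v (Suc j)) x) *
       (inner_n d (v j) w - inner_n d (v (Suc j)) w))"
  unfolding hard_grad_def inner_n_linear by simp

lemma hard_grad_Rn:
  "\<forall>j\<le>n. v j \<in> Rn d \<Longrightarrow> x \<in> Rn d \<Longrightarrow> hard_grad d \<mu> b a c n v x \<in> Rn d"
  by (auto simp: Rn_iff hard_grad_def)

lemma hard_fun_convex:
  assumes "0 \<le> a" "\<And>j. j < n \<Longrightarrow> 0 \<le> c j"
  shows "hard_fun d \<mu> b a c n v y \<ge> hard_fun d \<mu> b a c n v x +
    inner_n d (hard_grad d \<mu> b a c n v x) (y - x) + \<mu> / 2 * (norm_n d (y - x))\<^sup>2"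
proof -
  let ?l = "\<lambda>j x. inner_n d (v j) x - inner_n d (v (Suc j)) x"
  have "(\<Sum>j<n. phi (c j) (?l j x) + dz (c j) (?l j x) * (?l j y - ?l j x)) \<le> (\<Sum>j<n. phi (c j) (?l j y))"
    by (intro sum_mono phi_convex assms) auto
  then have "a * (\<Sum>j<n. phi (c j) (?l j x) + dz (c j) (?l j x) * (?l j y - ?l j x)) \<le>
      a * (\<Sum>j<n. phi (c j) (?l j y))"
    using assms(1) by (rule mult_left_mono)
  moreover have "inner_n d y y = inner_n d x x + 2 * inner_n d x (y - x) + (norm_n d (y - x))\<^sup>2"
    by (simp add: norm_n_sq inner_n_minus inner_n_commute)
  then have "\<mu> / 2 * inner_n d y y = \<mu> / 2 * inner_n d x x + \<mu> * inner_n d x (y - x) + \<mu> / 2 * (norm_n d (y - x))\<^sup>2"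
    by (simp add: algebra_simps)
  moreover have "(\<Sum>j<n. phi (c j) (?l j x) + dz (c j) (?l j x) * (?l j y - ?l j x)) =
      (\<Sum>j<n. phi (c j) (?l j x)) + (\<Sum>j<n. dz (c j) (?l j x) * ?l j (y - x))"
    unfolding sum.distrib[symmetric] by (intro sum.cong refl) (simp add: inner_n_minus)
  moreover have "b * inner_n d (v 0) (y - x) = b * inner_n d (v 0) y - b * inner_n d (v 0) x"
    by (simp add: inner_n_minus right_diff_distrib)
  ultimately show ?thesis
    unfolding hard_fun_def inner_hard_grad by (simp only: distrib_left)
qed

text \<open>The squared norm of the link map is at most 4: a squared difference is at most twice the
  sum of the squares, and Bessel is applied to the two shifts of the chain. This is the 4 in the
  smoothness constant \<open>\<mu> + 4 * a\<close>.\<close>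

lemma sum_link_sq_le:
  assumes "orthonormal_n d (Suc n) v"
  shows "(\<Sum>j<n. (inner_n d (v j) z - inner_n d (v (Suc j)) z)\<^sup>2) \<le> 4 * inner_n d z z"
proof -
  let ?q = "\<lambda>j. (inner_n d (v j) z)\<^sup>2"
  have le: "(\<Sum>j<Suc n. ?q j) \<le> inner_n d z z"
    using assms by (intro Bessel_n) (auto simp: orthonormal_n_def)
  have "(\<Sum>j<n. (inner_n d (v j) z - inner_n d (v (Suc j)) z)\<^sup>2) \<le> (\<Sum>j<n. 2 * ?q j + 2 * ?q (Suc j))"
  proof (intro sum_mono)
    fix j
    have "0 \<le> (inner_n d (v j) z + inner_n d (v (Suc j)) z)\<^sup>2" by simp
    then show "(inner_n d (v j) z - inner_n d (v (Suc j)) z)\<^sup>2 \<le> 2 * ?q j + 2 * ?q (Suc j)"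
      by (simp add: power2_eq_square algebra_simps)
  qed
  also have "\<dots> = 2 * (\<Sum>j<n. ?q j) + 2 * (\<Sum>j<n. ?q (Suc j))"
    by (simp add: sum.distrib sum_distrib_left)
  also have "\<dots> \<le> 2 * (\<Sum>j<Suc n. ?q j) + 2 * (\<Sum>j<Suc n. ?q j)"
  proof -
    have "(\<Sum>j<n. ?q j) \<le> (\<Sum>j<Suc n. ?q j)" by simp
    moreover have "(\<Sum>j<n. ?q (Suc j)) \<le> (\<Sum>j<Suc n. ?q j)"
      by (subst sum.lessThan_Suc_shift) simp
    ultimately show ?thesis by linarith
  qed
  finally show ?thesis using le by linarith
qed

text \<open>With A the link map, the difference \<open>D\<close> of gradients is \<mu> z + a A^T e,
  and e is dominated entrywise by A z because \<open>dz\<close> is nonexpansive. Pairing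
  \<open>D\<close> with itself and using the norm bound 2 for A on both sides gives the claim after
  division by the norm of \<open>D\<close>.\<close>

lemma hard_grad_Lipschitz:
  assumes v: "orthonormal_n d (Suc n) v" and "0 \<le> a" "0 \<le> \<mu>" "\<mu> + 4 * a \<le> \<beta>"
  shows "norm_n d (hard_grad d \<mu> b a c n v x - hard_grad d \<mu> b a c n v y) \<le> \<beta> * norm_n d (x - y)"
proof -
  let ?l = "\<lambda>j x. inner_n d (v j) x - inner_n d (v (Suc j)) x"
  define D where "D = hard_grad d \<mu> b a c n v x - hard_grad d \<mu> b a c n v y"
  define z where "z = x - y"
  define e where "e j = dz (c j) (?l j x) - dz (c j) (?l j y)" for j
  have l2: "L2_set (\<lambda>j. ?l j w) {..<n} \<le> 2 * norm_n d w" for w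
    unfolding L2_set_def
    by (intro real_le_lsqrt) (use sum_link_sq_le[OF v, of w] in \<open>simp_all add: sum_nonneg power_mult_distrib norm_n_sq\<close>)
  have e: "\<bar>e j\<bar> \<le> \<bar>?l j z\<bar>" for j
  proof -
    have "\<bar>e j\<bar> \<le> \<bar>?l j x - ?l j y\<bar>" unfolding e_def by (rule dz_nonexpansive)
    also have "?l j x - ?l j y = ?l j z" by (simp add: z_def inner_n_minus)
    finally show ?thesis .
  qed
  have "L2_set e {..<n} = L2_set (\<lambda>j. \<bar>e j\<bar>) {..<n}" by (simp add: L2_set_def)
  also have "\<dots> \<le> L2_set (\<lambda>j. \<bar>?l j z\<bar>) {..<n}" using e by (intro L2_set_mono) auto
  also have "\<dots> = L2_set (\<lambda>j. ?l j z) {..<n}" by (simp add: L2_set_def)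
  finally have e2: "L2_set e {..<n} \<le> 2 * norm_n d z" using l2[of z] by linarith
  have "inner_n d D w = \<mu> * inner_n d z w + a * (\<Sum>j<n. e j * ?l j w)" for w
  proof -
    have "(\<Sum>j<n. e j * ?l j w) = (\<Sum>j<n. dz (c j) (?l j x) * ?l j w) - (\<Sum>j<n. dz (c j) (?l j y) * ?l j w)"
      unfolding e_def left_diff_distrib sum_subtractf ..
    then show ?thesis
      unfolding D_def z_def inner_n_minus(1) inner_hard_grad
      by (simp only: right_diff_distrib[of a] right_diff_distrib[of \<mu>])
  qed
  then have "(norm_n d D)\<^sup>2 = \<mu> * inner_n d z D + a * (\<Sum>j<n. e j * ?l j D)"
    by (simp add: norm_n_sq)
  also have "\<dots> \<le> \<mu> * (norm_n d z * norm_n d D) + a * (4 * norm_n d z * norm_n d D)"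
  proof (intro add_mono mult_left_mono assms)
    show "inner_n d z D \<le> norm_n d z * norm_n d D" using inner_n_Cauchy[of d z D] by linarith
    have "(\<Sum>j<n. e j * ?l j D) \<le> (\<Sum>j<n. \<bar>e j\<bar> * \<bar>?l j D\<bar>)"
      by (intro sum_mono) (metis abs_ge_self abs_mult)
    also have "\<dots> \<le> L2_set e {..<n} * L2_set (\<lambda>j. ?l j D) {..<n}"
      by (rule L2_set_mult_ineq)
    also have "\<dots> \<le> (2 * norm_n d z) * (2 * norm_n d D)"
      by (intro mult_mono e2 l2) auto
    finally show "(\<Sum>j<n. e j * ?l j D) \<le> 4 * norm_n d z * norm_n d D" by simp
  qed
  also have "\<dots> = (\<mu> + 4 * a) * norm_n d z * norm_n d D" by (simp add: algebra_simps)
  also have "\<dots> \<le> \<beta> * norm_n d z * norm_n d D"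
    using assms by (intro mult_right_mono) auto
  finally have *: "norm_n d D * norm_n d D \<le> \<beta> * norm_n d z * norm_n d D"
    by (simp add: power2_eq_square)
  show ?thesis
  proof (cases "norm_n d D = 0")
    case True
    moreover have "0 \<le> \<beta> * norm_n d z" using assms by simp
    ultimately show ?thesis by (simp add: D_def z_def)
  next
    case False
    then have "norm_n d D > 0" using norm_n_ge0[of d D] by linarith
    with * show ?thesis by (simp add: D_def z_def)
  qed
qed

lemma inner_combination:
  assumes "orthonormal_n d N v" "j < N"
  shows "inner_n d (v j) (\<lambda>i. \<Sum>k<N. s k * v k i) = s j"
proof -
  have "inner_n d (v j) (\<lambda>i. \<Sum>k<N. s k * v k i) = (\<Sum>k<N. s k * inner_n d (v j) (v k))"
    by (simp add: inner_n_linear)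
  also have "\<dots> = (\<Sum>k<N. if k = j then s k else 0)"
    using assms by (intro sum.cong) (auto simp: orthonormal_n_def)
  also have "\<dots> = s j" using assms(2) by (simp add: sum.delta)
  finally show ?thesis .
qed

text \<open>Abel summation.\<close>

lemma telescoping_combination:
  fixes v :: "nat \<Rightarrow> nat \<Rightarrow> real"
  assumes "\<And>j. s j = t j - t (Suc j)"
  shows "(\<Sum>j<n. t (Suc j) * (v j i - v (Suc j) i)) = t 0 * v 0 i - t n * v n i - (\<Sum>j<n. s j * v j i)"
  by (induction n) (auto simp: assms algebra_simps)

text \<open>Balance of forces: \<open>t j\<close> is the tail sum of the coordinates from
  \<open>j\<close> on, so link \<open>j\<close> must carry the total pull
  \<open>\<mu> * t (Suc j)\<close> of everything beyond it, and the source \<open>b\<close> the pull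
  of the whole chain.\<close>

lemma hard_grad_combination_eq_0:
  assumes v: "orthonormal_n d (Suc n) v"
    and t: "\<And>j. s j = t j - t (Suc j)" "t (Suc n) = 0"
    and b: "b = \<mu> * t 0"
    and p: "\<And>j. j < n \<Longrightarrow> a * dz (c j) (s j - s (Suc j)) = \<mu> * t (Suc j)"
  shows "hard_grad d \<mu> b a c n v (\<lambda>i. \<Sum>k<Suc n. s k * v k i) = (\<lambda>i. 0)"
proof
  fix i
  let ?u = "\<lambda>i. \<Sum>k<Suc n. s k * v k i"
  have "a * (\<Sum>j<n. dz (c j) (inner_n d (v j) ?u - inner_n d (v (Suc j)) ?u) * (v j i - v (Suc j) i))
    = (\<Sum>j<n. \<mu> * t (Suc j) * (v j i - v (Suc j) i))"
    unfolding sum_distrib_left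
  proof (intro sum.cong refl)
    fix j assume "j \<in> {..<n}"
    then have j: "j < n" by simp
    have "inner_n d (v j) ?u - inner_n d (v (Suc j)) ?u = s j - s (Suc j)"
      using inner_combination[OF v, of j s] inner_combination[OF v, of "Suc j" s] j by simp
    then show "a * (dz (c j) (inner_n d (v j) ?u - inner_n d (v (Suc j)) ?u) * (v j i - v (Suc j) i)) =
      \<mu> * t (Suc j) * (v j i - v (Suc j) i)"
      using p[OF j] by simp
  qed
  also have "\<dots> = \<mu> * (t 0 * v 0 i - t n * v n i - (\<Sum>j<n. s j * v j i))"
    unfolding telescoping_combination[where s = s and t = t, OF t(1), symmetric] by (simp add: sum_distrib_left mult.assoc)
  finally show "hard_grad d \<mu> b a c n v ?u i = 0"
    using t(1)[of n] t(2) by (simp add: hard_grad_def b algebra_simps)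
qed

subsection \<open>The resisting oracle\<close>

definition query :: "(nat \<Rightarrow> transcript \<Rightarrow> nat \<Rightarrow> real) \<Rightarrow> ((nat \<Rightarrow> real) \<Rightarrow> real) \<Rightarrow> nat \<Rightarrow> nat \<Rightarrow> real" where
  "query q f t = q t (transcript_of q f t)"

lemma transcript_of_cong:
  assumes "\<And>s. s < t \<Longrightarrow> f (query q f s) = g (query q f s)"
  shows "transcript_of q f t = transcript_of q g t"
  using assms
proof (induction t)
  case (Suc t)
  then have "transcript_of q f t = transcript_of q g t" by simp
  with Suc.prems[of t] show ?case by (simp add: Let_def query_def)
qed simp

text \<open>The use of determinism: two functions that agree at the points visited so far lead to
  the same next query. A late change of the function is therefore invisible if it preserves those
  values.\<close>

lemma query_cong:
  assumes "\<And>s. s < t \<Longrightarrow> f (query q f s) = g (query q f s)"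
  shows "query q f t = query q g t"
  unfolding query_def using transcript_of_cong[of t f q g] assms by simp

lemma orthonormal_n_extend:
  assumes "orthonormal_n d i v" "u \<in> Rn d" "inner_n d u u = 1" "\<And>j. j < i \<Longrightarrow> inner_n d u (v j) = 0"
  shows "orthonormal_n d (Suc i) (v(i := u))"
proof -
  have "inner_n d ((v(i := u)) j) ((v(i := u)) k) = (if j = k then 1 else 0)" if "j < Suc i" "k < Suc i" for j k
    using assms that assms(4)[unfolded inner_n_commute[of d u]]
    by (cases "j = i"; cases "k = i") (simp_all add: orthonormal_n_def)
  moreover have "(v(i := u)) j \<in> Rn d" if "j < Suc i" for j
    using assms(1,2) that by (simp add: orthonormal_n_def)
  ultimately show ?thesis unfolding orthonormal_n_def by blast
qed

text \<open>The dead zones make the late choice of \<open>v i\<close> consistent with the values given so far.\<close>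

lemma hard_fun_upd_eq:
  assumes "0 \<le> \<delta>" "\<And>j. j < n \<Longrightarrow> 2 * \<delta> \<le> c j" "\<And>j. i \<le> j \<Longrightarrow> v j = (\<lambda>_. 0)"
    and "inner_n d u x = 0 \<or> 0 < i \<and> \<bar>inner_n d u x\<bar> \<le> \<delta> \<and> \<bar>inner_n d (v (i - 1)) x\<bar> \<le> \<delta>"
  shows "hard_fun d \<mu> b a c n (v(i := u)) x = hard_fun d \<mu> b a c n v x"
proof -
  have vi: "inner_n d (v i) x = 0" "inner_n d (v (Suc i)) x = 0" using assms(3) by simp_all
  show ?thesis
  proof (cases "inner_n d u x = 0")
    case True
    then have "inner_n d ((v(i := u)) j) x = inner_n d (v j) x" for j by (simp add: vi)
    then show ?thesis by (simp only: hard_fun_def)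
  next
    case False
    with assms(4) have i: "0 < i" and u: "\<bar>inner_n d u x\<bar> \<le> \<delta>" and p: "\<bar>inner_n d (v (i - 1)) x\<bar> \<le> \<delta>"
      by auto
    have "phi (c j) (inner_n d ((v(i := u)) j) x - inner_n d ((v(i := u)) (Suc j)) x) =
        phi (c j) (inner_n d (v j) x - inner_n d (v (Suc j)) x)" if j: "j < n" for j
    proof -
      consider "j = i" | "Suc j = i" | "j \<noteq> i" "Suc j \<noteq> i" by blast
      then show ?thesis
      proof cases
        case 1
        then show ?thesis using assms(1) assms(2)[OF j] u vi by (simp add: phi_eq_0)
      next
        case 2
        then have "phi (c j) (inner_n d (v j) x - inner_n d u x) = 0" "phi (c j) (inner_n d (v j) x) = 0"
          using assms(1) assms(2)[OF j] u p by (auto intro!: phi_eq_0)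
        then show ?thesis using 2 vi by simp
      qed simp
    qed
    then show ?thesis using i by (simp add: hard_fun_def)
  qed
qed

text \<open>During stage \<open>i\<close> the answers come from the function in which all vectors
  from \<open>v i\<close> on are zero. At its end \<open>v i\<close> is chosen, subject to at most
  \<open>i + m\<close> exact constraints (earlier vectors and the queries of the stage), which
  leaves \<open>k\<close> dimensions for near-orthogonality to the earlier queries.
  \<open>hard_fun_upd_eq\<close> shows that no answer given so far changes.\<close>

lemma resisting_oracle:
  assumes ball: "\<And>f t. query q f t \<in> cball_n d R" and "0 < R"
    and m: "0 < m" and dim: "m + n + k \<le> d" "0 < k"
    and \<delta>: "R * sqrt (2 * ln (2 * real (Suc n * m)) / real k) \<le> \<delta>"
    and c: "\<And>j. j < n \<Longrightarrow> 2 * \<delta> \<le> c j"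
  shows "\<exists>v. orthonormal_n d (Suc n) v \<and> (\<forall>t < Suc n * m. \<forall>j \<le> n.
    t div m \<le> j \<longrightarrow> \<bar>inner_n d (v j) (query q (hard_fun d \<mu> b a c n v) t)\<bar> \<le> \<delta>)"
proof -
  let ?f = "\<lambda>v. hard_fun d \<mu> b a c n v"
  have "1 \<le> Suc n * m" using m by simp
  then have "real 1 \<le> real (Suc n * m)" by (rule of_nat_mono)
  then have "1 \<le> 2 * real (Suc n * m)" unfolding of_nat_1 by linarith
  then have "0 \<le> R * sqrt (2 * ln (2 * real (Suc n * m)) / real k)" using \<open>0 < R\<close> by simp
  then have \<delta>0: "0 \<le> \<delta>" using \<delta> by linarith
  have "\<exists>v. orthonormal_n d i v \<and> (\<forall>j\<ge>i. v j = (\<lambda>_. 0)) \<and> (\<forall>t < i * m. \<forall>j < i.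
      (j = t div m \<longrightarrow> inner_n d (v j) (query q (?f v) t) = 0) \<and>
      (t div m < j \<longrightarrow> \<bar>inner_n d (v j) (query q (?f v) t)\<bar> \<le> \<delta>))"
    if "i \<le> Suc n" for i
    using that
  proof (induction i)
    case 0
    show ?case by (intro exI[of _ "\<lambda>_ _. 0"]) (simp add: orthonormal_n_def)
  next
    case (Suc i)
    from Suc.prems have "i \<le> Suc n" by simp
    from Suc.IH[OF this] obtain v where v: "orthonormal_n d i v" "\<And>j. j \<ge> i \<Longrightarrow> v j = (\<lambda>_. 0)"
      and small: "\<And>t j. t < i * m \<Longrightarrow> j < i \<Longrightarrow> j = t div m \<Longrightarrow> inner_n d (v j) (query q (?f v) t) = 0"
        "\<And>t j. t < i * m \<Longrightarrow> j < i \<Longrightarrow> t div m < j \<Longrightarrow> \<bar>inner_n d (v j) (query q (?f v) t)\<bar> \<le> \<delta>"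
      by blast
    define X where "X = query q (?f v)"
    \<comment> \<open>Only the queries of the current stage are constrained exactly; the
      \<open>i * m\<close> earlier ones may outnumber the dimension.\<close>
    define W where "W = v ` {..<i} \<union> X ` {i * m..<Suc i * m}"
    have "card W \<le> card (v ` {..<i}) + card (X ` {i * m..<Suc i * m})"
      unfolding W_def by (rule card_Un_le)
    also have "\<dots> \<le> i + m"
      using card_image_le[of "{..<i}" v] card_image_le[of "{i * m..<Suc i * m}" X] by simp
    finally have cW: "card W + k \<le> d" using dim Suc.prems by simp
    have "card (X ` {..<i * m}) \<le> i * m"
      using card_image_le[of "{..<i * m}" X] by simp
    also have "\<dots> \<le> Suc n * m" using Suc.prems by (intro mult_right_mono) auto
    finally have cP: "card (X ` {..<i * m}) \<le> Suc n * m" .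
    have "\<exists>u\<in>Rn d. inner_n d u u = 1 \<and> (\<forall>w\<in>W. inner_n d u w = 0) \<and>
      (\<forall>x\<in>X ` {..<i * m}. \<bar>inner_n d u x\<bar> \<le> R * sqrt (2 * ln (2 * real (Suc n * m)) / real k))"
      using ball m by (intro exists_almost_orthogonal[OF _ cW dim(2) _ cP _ \<open>0 < R\<close>])
        (auto simp: W_def X_def cball_n_iff)
    then obtain u where u: "u \<in> Rn d" "inner_n d u u = 1" "\<And>w. w \<in> W \<Longrightarrow> inner_n d u w = 0"
      "\<And>t. t < i * m \<Longrightarrow> \<bar>inner_n d u (X t)\<bar> \<le> \<delta>"
      using \<delta> by (meson image_eqI lessThan_iff order_trans)
    have stage: "inner_n d u (X t) = 0" if "t div m = i" for t
    proof (rule u(3))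
      have "t = i * m + t mod m" using that by (metis div_mult_mod_eq)
      moreover have "t mod m < m" using m by simp
      moreover have "Suc i * m = i * m + m" by simp
      ultimately have "t \<in> {i * m..<Suc i * m}" unfolding atLeastLessThan_iff by linarith
      then show "X t \<in> W" by (simp add: W_def)
    qed
    let ?v = "v(i := u)"
    \<comment> \<open>In stage \<open>i\<close> the vector \<open>v (i - 1)\<close> may already be
      explored, so only a vanishing product with \<open>u\<close> leaves link \<open>i - 1\<close>
      unchanged. At earlier queries both ends of that link are at most \<delta> in size, so it lies
      in its dead zone before and after the change; this is why \<open>c j\<close> must be at least
      2 \<delta>.\<close>
    have eq: "?f ?v (X t) = ?f v (X t)" if t: "t < Suc i * m" for t
    proof (rule hard_fun_upd_eq[OF \<delta>0 c v(2)])
      have "t div m \<le> i" using t m by (simp add: less_mult_imp_div_less less_Suc_eq_le[symmetric])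
      then consider "t div m = i" | "t div m < i" by linarith
      then show "inner_n d u (X t) = 0 \<or> 0 < i \<and> \<bar>inner_n d u (X t)\<bar> \<le> \<delta> \<and> \<bar>inner_n d (v (i - 1)) (X t)\<bar> \<le> \<delta>"
      proof cases
        case 2
        then have "t < i * m" using m by (simp add: div_less_iff_less_mult)
        moreover have "t div m = i - 1 \<or> t div m < i - 1" using 2 by linarith
        ultimately have "\<bar>inner_n d (v (i - 1)) (X t)\<bar> \<le> \<delta>"
          using small[of t "i - 1"] 2 \<delta>0 by (auto simp: X_def)
        with u(4)[OF \<open>t < i * m\<close>] 2 show ?thesis by auto
      qed (simp add: stage)
    qed
    \<comment> \<open>Equal values imply that the run against the updated function visits the same
      points up to the end of the stage, so the induction hypothesis carries over.\<close>
    have X: "query q (?f ?v) t = X t" if "t < Suc i * m" for t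
      unfolding X_def
      by (rule query_cong[symmetric]) (use eq that in \<open>auto simp: X_def\<close>)
    show ?case
    proof (intro exI[of _ ?v] conjI allI impI)
      show "orthonormal_n d (Suc i) ?v"
        using u by (intro orthonormal_n_extend v(1)) (auto simp: W_def)
      show "?v j = (\<lambda>_. 0)" if "Suc i \<le> j" for j using that v(2) by simp
    next
      fix t j assume t: "t < Suc i * m" and j: "j < Suc i" and jt: "j = t div m"
      show "inner_n d (?v j) (query q (?f ?v) t) = 0"
      proof (cases "j = i")
        case True
        then show ?thesis using stage jt X[OF t] by simp
      next
        case False
        then have ji: "j < i" using j by simp
        then have "t < i * m" using jt m by (simp add: div_less_iff_less_mult)
        from small(1)[OF this ji jt] show ?thesis
          unfolding X[OF t] X_def[symmetric] using False by simp
      qed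
    next
      fix t j assume t: "t < Suc i * m" and j: "j < Suc i" and jt: "t div m < j"
      then have ti: "t < i * m" using m by (simp add: div_less_iff_less_mult[symmetric])
      show "\<bar>inner_n d (?v j) (query q (?f ?v) t)\<bar> \<le> \<delta>"
      proof (cases "j = i")
        case True
        then show ?thesis unfolding X[OF t] using u(4)[OF ti] by simp
      next
        case False
        then have "j < i" using j by simp
        from small(2)[OF ti this jt] show ?thesis
          unfolding X[OF t] X_def[symmetric] using False by simp
      qed
    qed
  qed
  from this[of "Suc n"] obtain v where v: "orthonormal_n d (Suc n) v" and
    small: "\<And>t j. t < Suc n * m \<Longrightarrow> j < Suc n \<Longrightarrow>
      (j = t div m \<longrightarrow> inner_n d (v j) (query q (?f v) t) = 0) \<and>
      (t div m < j \<longrightarrow> \<bar>inner_n d (v j) (query q (?f v) t)\<bar> \<le> \<delta>)"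
    by blast
  have "\<bar>inner_n d (v j) (query q (?f v) t)\<bar> \<le> \<delta>" if "t < Suc n * m" "j \<le> n" "t div m \<le> j" for t j
    using small[OF that(1), of j] that \<delta>0 by (cases "j = t div m") auto
  with v show ?thesis by blast
qed

subsection \<open>The lower bound\<close>

text \<open>Measurable maps are only known to reach the ball from points of their source space, so
  the actual transcripts have to be located there.\<close>

lemma transcript_in_space:
  assumes "\<And>s. s < t \<Longrightarrow> q s \<in> transcript_space d R s \<rightarrow>\<^sub>M ball_borel d R"
  shows "transcript_of q f t \<in> space (transcript_space d R t)"
  using assms
proof (induction t)
  case 0
  show ?case by (simp add: transcript_space_def space_PiM)
next
  case (Suc t)
  then have t: "transcript_of q f t \<in> space (transcript_space d R t)" by simp
  have "q t (transcript_of q f t) \<in> space (ball_borel d R)"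
    using measurable_space[OF Suc.prems[of t] t] by simp
  with t show ?case
    by (auto simp: transcript_space_def space_PiM space_pair_measure Let_def PiE_iff less_Suc_eq extensional_def)
qed

text \<open>The terminal map is treated as query number \<open>T\<close>, so the oracle also
  controls the output. The constant zero after that keeps all later queries in the ball, as
  \<open>resisting_oracle\<close> requires.\<close>

lemma query_in_ball:
  assumes "is_algorithm d R T q qout" "0 \<le> R"
  shows "query (\<lambda>t. if t < T then q t else if t = T then qout else (\<lambda>_ _. 0)) f t \<in> cball_n d R"
proof -
  define q' where "q' = (\<lambda>t. if t < T then q t else if t = T then qout else (\<lambda>_ _. 0))"
  have sp: "space (ball_borel d R) = cball_n d R"
    by (simp add: ball_borel_def space_restrict_space)
  have m: "q' s \<in> transcript_space d R s \<rightarrow>\<^sub>M ball_borel d R" if "s \<le> T" for s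
    using assms(1) that by (auto simp: is_algorithm_def q'_def)
  have "query q' f t \<in> cball_n d R"
  proof (cases "t \<le> T")
    case True
    then have "transcript_of q' f t \<in> space (transcript_space d R t)"
      by (intro transcript_in_space m) simp
    from measurable_space[OF m[OF True] this] show ?thesis by (simp add: query_def sp)
  next
    case False
    then show ?thesis using assms(2) by (simp add: query_def q'_def cball_n_iff Rn_iff)
  qed
  then show ?thesis by (simp add: q'_def)
qed

lemma alg_output_eq_query:
  "alg_output T q qout f = query (\<lambda>t. if t < T then q t else if t = T then qout else (\<lambda>_ _. 0)) f T"
proof -
  have "transcript_of (\<lambda>t. if t < T then q t else if t = T then qout else (\<lambda>_ _. 0)) f t = transcript_of q f t"
    if "t \<le> T" for t
    using that by (induction t) (simp_all add: Let_def)
  then show ?thesis by (simp add: alg_output_def query_def)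
qed

text \<open>The minimizer has coordinates \<open>s j\<close> between \<open>S\<close> and \<open>2 S\<close> decreasing linearly in the chain;
  the dead zones \<open>c j\<close> are chosen to make the gradient vanish there. The algorithm has not moved
  along the second half of the chain, which alone contributes the claimed gap.\<close>

lemma hard_instance:
  fixes R :: real and l :: nat
  defines "n \<equiv> 2 * l"
  defines "S \<equiv> R / (4 * sqrt (real (Suc n)))"
  assumes alg: "is_algorithm d R T q qout" and R: "0 < R" and mu: "0 < \<mu>" "\<mu> \<le> \<nu>" "\<nu> \<le> \<beta>"
    and n: "16 * \<nu> * real (Suc n) * real n \<le> \<beta> - \<nu>"
    and T: "T < Suc l * m" and dim: "m + n + k \<le> d" "0 < k"
    and \<delta>: "R * sqrt (2 * ln (2 * real (Suc n * m)) / real k) \<le> S / (4 * real (Suc n))"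
  shows "\<exists>f\<in>obj_class d R \<mu> \<beta>. \<nu> * R\<^sup>2 / 256 \<le> f (alg_output T q qout f) - f (minimizer d f)"
proof -
  define N where "N = real (Suc n)"
  have N: "0 < N" by (simp add: N_def)
  define s where "s j = (if j \<le> n then S * (2 - real j / N) else 0)" for j
  define t where "t j = (\<Sum>i\<in>{j..n}. s i)" for j
  \<comment> \<open>The largest coupling that the smoothness constant \<open>\<nu> + 4 * a\<close>
    permits.\<close>
  define a where "a = (\<beta> - \<nu>) / 4"
  define b where "b = \<nu> * t 0"
  define c where "c j = S / N - \<nu> * t (Suc j) / a" for j
  define \<delta> where "\<delta> = S / (4 * N)"
  define q' where "q' = (\<lambda>t. if t < T then q t else if t = T then qout else (\<lambda>_ _. 0))"
  have S: "0 < S" using R by (simp add: S_def)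
  have s_bounds: "S \<le> s j" "s j \<le> 2 * S" if "j \<le> n" for j
  proof -
    have "real j / N \<le> 1" using that N by (simp add: N_def)
    then have "S * 1 \<le> S * (2 - real j / N)" using S by (intro mult_left_mono) auto
    then show "S \<le> s j" using that by (simp add: s_def)
    have "S * (2 - real j / N) \<le> S * 2" using S N by (intro mult_left_mono) auto
    then show "s j \<le> 2 * S" using that by (simp add: s_def)
  qed
  have s_out: "s j = 0" if "\<not> j \<le> n" for j using that by (simp add: s_def)
  have s0: "0 \<le> s j" for j
  proof (cases "j \<le> n")
    case True
    from s_bounds(1)[OF this] S show ?thesis by linarith
  qed (simp add: s_out)
  have t: "s j = t j - t (Suc j)" for j
  proof (cases "j \<le> n")
    case True
    then show ?thesis unfolding t_def by (subst sum.atLeast_Suc_atMost) simp_all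
  qed (simp add: t_def s_out)
  have tN: "t (Suc n) = 0" by (simp add: t_def)
  have t0: "0 \<le> t j" for j using s0 by (simp add: t_def sum_nonneg)
  have t_le: "t (Suc j) \<le> 2 * S * real n" for j
  proof -
    have "t (Suc j) \<le> real (card {Suc j..n}) * (2 * S)"
      unfolding t_def using s_bounds(2) by (intro sum_bounded_above) auto
    also have "\<dots> \<le> real n * (2 * S)" using S by (intro mult_right_mono) auto
    finally show ?thesis by (simp add: mult_ac)
  qed
  have a0: "0 \<le> a" using mu by (simp add: a_def)
  \<comment> \<open>The restriction to \<open>j < n\<close> matters: for \<open>n = 0\<close> there
    is no link, and \<open>\<nu> = \<beta>\<close> may hold.\<close>
  have a_pos: "0 < a" if "j < n" for j
  proof -
    have "0 < 16 * \<nu> * N * real n" using mu that N by simp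
    with n[folded N_def] have "0 < \<beta> - \<nu>" by linarith
    then show ?thesis by (simp add: a_def)
  qed
  \<comment> \<open>The assumption on \<open>16 * \<nu> * real (Suc n) * real n\<close> says that
    the force term takes at most half of the link length \<open>S / N\<close>, so the dead zone
    keeps the other half, which is twice \<delta>.\<close>
  have c_le: "2 * \<delta> \<le> c j" if j: "j < n" for j
  proof -
    have "\<nu> * t (Suc j) * (2 * N) \<le> \<nu> * (2 * S * real n) * (2 * N)"
      using mu N by (intro mult_right_mono mult_left_mono t_le) auto
    also have "\<dots> = S * (4 * \<nu> * N * real n)" by algebra
    also have "\<dots> \<le> S * a" proof (rule mult_left_mono)
      have "4 * a = \<beta> - \<nu>" by (simp add: a_def)
      with n[folded N_def] show "4 * \<nu> * N * real n \<le> a" by linarith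
    qed (use S in simp)
    finally have "\<nu> * t (Suc j) / a \<le> S / (2 * N)"
      using a_pos[OF j] N by (simp add: field_simps)
    moreover have "S / N = 2 * (S / (2 * N))" "2 * \<delta> = S / (2 * N)"
      by (simp_all add: \<delta>_def)
    ultimately show ?thesis unfolding c_def by linarith
  qed
  have \<delta>0: "0 \<le> \<delta>" using S N by (simp add: \<delta>_def)
  have c0: "0 \<le> c j" if "j < n" for j using c_le[OF that] \<delta>0 by linarith
  have p: "a * dz (c j) (s j - s (Suc j)) = \<nu> * t (Suc j)" if j: "j < n" for j
  proof -
    have "s j - s (Suc j) = S * (2 - real j / N) - S * (2 - real (Suc j) / N)"
      using j by (simp add: s_def)
    also have "\<dots> = S / N" using N by (simp add: field_simps)
    finally have ss: "s j - s (Suc j) = S / N" .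
    have "0 \<le> \<nu> * t (Suc j) / a" using mu t0 a0 by simp
    then have "dz (c j) (S / N) = \<nu> * t (Suc j) / a"
      using c0[OF j] by (subst dz_above) (auto simp: c_def)
    then show ?thesis using a_pos[OF j] by (simp add: ss)
  qed
  have "m > 0" using T by (cases m) auto
  have ball: "query q' f t \<in> cball_n d R" for f t
    unfolding q'_def using query_in_ball[OF alg] R by simp
  have \<delta>': "R * sqrt (2 * ln (2 * real (Suc n * m)) / real k) \<le> \<delta>"
    using \<delta> by (simp only: \<delta>_def N_def)
  have "\<exists>v. orthonormal_n d (Suc n) v \<and> (\<forall>t < Suc n * m. \<forall>j \<le> n.
    t div m \<le> j \<longrightarrow> \<bar>inner_n d (v j) (query q' (hard_fun d \<nu> b a c n v) t)\<bar> \<le> \<delta>)"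
    using ball R \<open>m > 0\<close> dim \<delta>' c_le by (rule resisting_oracle)
  then obtain v where v: "orthonormal_n d (Suc n) v" and
    small: "\<And>i j. i < Suc n * m \<Longrightarrow> j \<le> n \<Longrightarrow> i div m \<le> j \<Longrightarrow>
      \<bar>inner_n d (v j) (query q' (hard_fun d \<nu> b a c n v) i)\<bar> \<le> \<delta>"
    by blast
  define f where "f = hard_fun d \<nu> b a c n v"
  define u where "u = (\<lambda>i. \<Sum>k<Suc n. s k * v k i)"
  have vu: "inner_n d (v j) u = s j" if "j < Suc n" for j
    unfolding u_def by (rule inner_combination[OF v that])
  have vRn: "\<forall>j\<le>n. v j \<in> Rn d" using v by (simp add: orthonormal_n_def)
  then have uRn: "u \<in> Rn d" by (auto simp: u_def Rn_iff)
  have Gu: "hard_grad d \<nu> b a c n v u = (\<lambda>i. 0)"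
    unfolding u_def by (rule hard_grad_combination_eq_0[OF v t tN b_def p])
  have "inner_n d u u = (\<Sum>k<Suc n. s k * inner_n d (v k) u)"
    by (subst (1) u_def) (simp only: inner_n_linear)
  also have "\<dots> = (\<Sum>k<Suc n. s k * s k)" by (intro sum.cong) (simp_all add: vu)
  also have "\<dots> \<le> real (card {..<Suc n}) * (2 * S * (2 * S))"
    using s_bounds(2) s0 S by (intro sum_bounded_above mult_mono) auto
  \<comment> \<open>\<open>S\<close> is defined by this requirement: N coordinates of size at most 2
    S must fit into the ball of radius R / 2.\<close>
  also have "\<dots> = (R / 2)\<^sup>2"
    using N by (simp add: S_def N_def[symmetric] power2_eq_square field_simps)
  finally have u_norm: "norm_n d u \<le> R / 2" using R by (subst norm_n_le_iff) auto
  have conv: "f y \<ge> f x + inner_n d (hard_grad d \<nu> b a c n v x) (y - x) + \<nu> / 2 * (norm_n d (y - x))\<^sup>2" for x y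
    unfolding f_def by (rule hard_fun_convex[OF a0 c0])
  have lip: "norm_n d (hard_grad d \<nu> b a c n v x - hard_grad d \<nu> b a c n v y) \<le> \<beta> * norm_n d (x - y)" for x y
  proof (rule hard_grad_Lipschitz[OF v a0])
    show "0 \<le> \<nu>" using mu by simp
    have "4 * a = \<beta> - \<nu>" by (simp add: a_def)
    then show "\<nu> + 4 * a \<le> \<beta>" by linarith
  qed
  have "0 < \<beta>" using mu by simp
  note cls = obj_classI[where G = "hard_grad d \<nu> b a c n v" and f = f,
    OF hard_grad_Rn[OF vRn] conv lip uRn _ u_norm mu(1,2) \<open>0 < \<beta>\<close>]
  have f_cls: "f \<in> obj_class d R \<mu> \<beta>" and f_min: "minimizer d f = u"
    by (rule cls; simp add: Gu)+
  define y where "y = alg_output T q qout f"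
  have y: "y = query q' f T" by (simp add: y_def q'_def alg_output_eq_query)
  \<comment> \<open>The output, as query \<open>T\<close>, belongs to a stage up to
    \<open>l\<close>, so its products with \<open>v l\<close>, ..., \<open>v n\<close> are at most
    \<delta>. These are \<open>l + 1\<close> of the \<open>2 * l + 1\<close> coordinates, each off
    by at least S / 2.\<close>
  have "T div m < Suc l" using T \<open>m > 0\<close> by (simp add: div_less_iff_less_mult)
  then have Tl: "T div m \<le> l" by simp
  have "Suc l * m \<le> Suc n * m" by (intro mult_right_mono) (auto simp: n_def)
  with T have TN: "T < Suc n * m" by linarith
  have "1 \<le> N" by (simp add: N_def)
  then have "S * 1 \<le> S * (2 * N)" using S by (intro mult_left_mono) auto
  then have "\<delta> \<le> S / 2" using N by (simp add: \<delta>_def field_simps)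
  have far: "(S / 2)\<^sup>2 \<le> (inner_n d (v j) (y - u))\<^sup>2" if "j \<in> {l..n}" for j
  proof -
    have "\<bar>inner_n d (v j) y\<bar> \<le> \<delta>"
      using small[OF TN, of j] that Tl by (simp add: y f_def)
    moreover have "inner_n d (v j) (y - u) = inner_n d (v j) y - s j"
      using that by (simp add: inner_n_minus vu)
    ultimately have "S / 2 \<le> \<bar>inner_n d (v j) (y - u)\<bar>"
      using \<open>\<delta> \<le> S / 2\<close> s_bounds(1)[of j] that by auto
    then show ?thesis using S by (subst power2_abs[symmetric]) (intro power_mono, auto)
  qed
  have "R\<^sup>2 / 128 \<le> real (card {l..n}) * (S / 2)\<^sup>2"
  proof -
    have "card {l..n} = Suc l" by (simp add: n_def)
    then have "N / 2 \<le> real (card {l..n})" by (simp add: N_def n_def)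
    then have "N / 2 * (S / 2)\<^sup>2 \<le> real (card {l..n}) * (S / 2)\<^sup>2" by (rule mult_right_mono) simp
    moreover have SN: "S = R / (4 * sqrt N)" by (simp only: S_def N_def)
    have "N / 2 * (S / 2)\<^sup>2 = R\<^sup>2 / 128"
      unfolding SN using N by (simp add: power_divide power_mult_distrib)
    ultimately show ?thesis by simp
  qed
  also have "\<dots> \<le> (\<Sum>j\<in>{l..n}. (inner_n d (v j) (y - u))\<^sup>2)"
    using far by (intro sum_bounded_below) auto
  also have "\<dots> \<le> (\<Sum>j<Suc n. (inner_n d (v j) (y - u))\<^sup>2)"
    by (intro sum_mono2) auto
  also have "\<dots> \<le> (norm_n d (y - u))\<^sup>2"
    unfolding norm_n_sq using v by (intro Bessel_n) (auto simp: orthonormal_n_def)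
  finally have "\<nu> / 2 * (R\<^sup>2 / 128) \<le> \<nu> / 2 * (norm_n d (y - u))\<^sup>2"
    using mu by (intro mult_left_mono) auto
  moreover have "f y \<ge> f u + \<nu> / 2 * (norm_n d (y - u))\<^sup>2"
    using conv[of u y] by (simp add: Gu)
  ultimately have "\<nu> * R\<^sup>2 / 256 \<le> f y - f u" by simp
  then show ?thesis using f_cls f_min by (auto simp: y_def)
qed

section \<open>Choice of the parameters in the lower bound\<close>

lemma ln_le_two_sqrt: "1 \<le> x \<Longrightarrow> ln (exp 1 * x) \<le> 2 * sqrt (x::real)"
  using ln_le_minus_one[of "sqrt x"] by (simp add: ln_mult ln_sqrt)

lemma query_count_lower:
  fixes d :: nat and R \<mu> \<beta> \<epsilon> :: real
  defines "Q \<equiv> \<beta> * R\<^sup>2 / \<epsilon>" and "\<kappa> \<equiv> \<beta> / \<mu>"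
  assumes d: "2 ^ 26 \<le> d" and R: "0 < R" and mu: "0 < \<mu>" "\<mu> \<le> \<beta>" and eps: "0 < \<epsilon>" "257 * \<epsilon> \<le> \<beta> * R\<^sup>2"
    and small: "min Q \<kappa> \<le> (real d / ln (exp 1 * real d)) powr (2 / 3)"
    and alg: "is_algorithm d R T q qout"
    and acc: "\<And>f. f \<in> obj_class d R \<mu> \<beta> \<Longrightarrow> f (alg_output T q qout f) - f (minimizer d f) \<le> \<epsilon>"
  shows "1 / 6528 * real d * sqrt (min Q \<kappa>) \<le> real T"
proof -
  define M where "M = min Q \<kappa>"
  \<comment> \<open>By the bound Q / 257, the gap \<open>\<nu> * R\<^sup>2 / 256\<close> of
    \<open>hard_instance\<close> is at least 257 / 256 times \<epsilon>, hence too large. The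
    assumption on \<epsilon> makes Q / 257 at least 1, so that \<nu> \<le> \<beta>.\<close>
  define K where "K = min \<kappa> (Q / 257)"
  define \<nu> where "\<nu> = \<beta> / K"
  \<comment> \<open>For l > 0, N \<le> 3 l, so 48 = 3 * 16 yields N \<le> sqrt M / 16; moreover 16 N
    n = 64 l^2 + 32 l stays below K - 1. For \<open>l = 0\<close> the chain has a single vector and
    no link.\<close>
  define l where "l = nat \<lfloor>sqrt K / 48\<rfloor>"
  define n where "n = 2 * l"
  define N where "N = real (Suc n)"
  define m where "m = d div 4"
  define k where "k = d div 2"
  define L where "L = ln (exp 1 * real d)"
  have \<beta>: "0 < \<beta>" using mu by linarith
  have "1 \<le> \<kappa>" using mu by (simp add: \<kappa>_def)
  moreover have Q257: "1 \<le> Q / 257" using eps by (simp add: Q_def field_simps)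
  ultimately have K1: "1 \<le> K" by (simp add: K_def)
  have KM: "K \<le> M" "M \<le> 257 * K" using Q257 \<open>1 \<le> \<kappa>\<close> by (auto simp: K_def M_def min_def)
  have dr: "67108864 \<le> real d" using of_nat_mono[OF d, where 'a = real] by simp
  have L1: "1 \<le> L" using dr by (simp add: L_def ln_mult)
  have M3: "sqrt M ^ 3 * L \<le> real d"
  proof -
    have "sqrt M ^ 3 = M powr (3 / 2)"
    proof -
      have "sqrt M ^ 3 = sqrt M powr 3" using K1 KM by (simp add: powr_realpow)
      also have "\<dots> = M powr (3 / 2)" using K1 KM by (simp add: powr_half_sqrt[symmetric] powr_powr)
      finally show ?thesis .
    qed
    also have "\<dots> \<le> ((real d / L) powr (2 / 3)) powr (3 / 2)"
      using small K1 KM by (intro powr_mono2) (auto simp: M_def L_def)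
    also have "\<dots> = real d / L" using L1 by (simp add: powr_powr)
    finally show ?thesis using L1 by (simp add: field_simps)
  qed
  \<comment> \<open>The form needed for \<delta>: 1024 N^3 L \<le> d / 4 \<le> k. For l > 0 it is
    the hypothesis on the minimum, with 4096 = 16^3. For \<open>l = 0\<close> it reads 4096 L \<le>
    d, which follows from L \<le> 2 sqrt d once sqrt d \<ge> 8192; this is the origin of
    2^26.\<close>
  have N3: "4096 * N ^ 3 * L \<le> real d"
  proof (cases "l = 0")
    case True
    have "L \<le> 2 * sqrt (real d)" unfolding L_def using dr by (intro ln_le_two_sqrt) simp
    moreover have "8192 \<le> sqrt (real d)" using dr by (intro real_le_rsqrt) simp
    then have "8192 * sqrt (real d) \<le> sqrt (real d) * sqrt (real d)" by (intro mult_right_mono) auto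
    ultimately show ?thesis using True by (simp add: N_def n_def)
  next
    case False
    then have "real l \<le> sqrt K / 48" unfolding l_def by (intro of_nat_floor) (use K1 in simp)
    moreover have "N \<le> 3 * real l" using False by (simp add: N_def n_def)
    moreover have "sqrt K \<le> sqrt M" using KM by simp
    ultimately have "N \<le> sqrt M / 16" by linarith
    then have "N ^ 3 \<le> (sqrt M / 16) ^ 3" by (intro power_mono) (simp_all add: N_def)
    then have "4096 * N ^ 3 \<le> sqrt M ^ 3" by (simp add: power_divide)
    then have "4096 * N ^ 3 * L \<le> sqrt M ^ 3 * L" using L1 by (intro mult_right_mono) auto
    with M3 show ?thesis by linarith
  qed
  have N1: "1 \<le> N" by (simp add: N_def)
  have "N ^ 1 * 1 \<le> N ^ 3 * L" using N1 L1 by (intro mult_mono power_increasing) auto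
  then have Nd: "4096 * N \<le> real d" using N3 by simp
  have md: "real d / 8 \<le> real m" "real m \<le> real d / 4" using dr unfolding m_def by linarith+
  have kd: "real d / 4 \<le> real k" "real k \<le> real d / 2" using dr unfolding k_def by linarith+
  have dim: "m + n + k \<le> d"
  proof -
    have "real (m + n + k) \<le> real d" using md kd Nd by (simp add: N_def)
    then show ?thesis by (simp only: of_nat_le_iff)
  qed
  have k0: "0 < k" using kd dr by (intro Nat.gr0I) simp
  have m0: "0 < real m" using md dr by linarith
  define S where "S = R / (4 * sqrt N)"
  have \<delta>: "R * sqrt (2 * ln (2 * real (Suc n * m)) / real k) \<le> S / (4 * N)"
  proof -
    have "2 * (N * real m) \<le> 2 * (real d * (real d / 4))"
      using Nd N1 md dr by (intro mult_left_mono mult_mono) auto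
    also have "\<dots> \<le> 1 * (real d * real d)" by simp
    also have "\<dots> \<le> (exp 1 * exp 1) * (real d * real d)" by (intro mult_right_mono) (auto simp: exp_add[symmetric])
    finally have le: "2 * (N * real m) \<le> (exp 1 * real d) * (exp 1 * real d)" by (simp add: mult_ac)
    have "ln (2 * (N * real m)) \<le> ln ((exp 1 * real d) * (exp 1 * real d))"
      using le N1 m0 dr by (subst ln_le_cancel_iff) auto
    also have "\<dots> = 2 * L" using dr by (simp add: L_def ln_mult)
    finally have lnle: "ln (2 * (N * real m)) \<le> 2 * L" .
    have "256 * N ^ 3 * (2 * ln (2 * (N * real m))) \<le> 256 * N ^ 3 * (2 * (2 * L))"
      using N1 lnle by (intro mult_left_mono) auto
    also have "\<dots> \<le> real k" using N3 kd by linarith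
    finally have "2 * ln (2 * (N * real m)) / real k \<le> 1 / (256 * N ^ 3)"
      using k0 N1 by (simp add: field_simps)
    also have "\<dots> = (1 / (16 * (N * sqrt N)))\<^sup>2"
      using N1 by (simp add: power_divide power_mult_distrib power3_eq_cube power2_eq_square)
    finally have "sqrt (2 * ln (2 * (N * real m)) / real k) \<le> 1 / (16 * (N * sqrt N))"
      using N1 by (intro real_le_lsqrt) auto
    then have "R * sqrt (2 * ln (2 * (N * real m)) / real k) \<le> R * (1 / (16 * (N * sqrt N)))"
      using R by (intro mult_left_mono) auto
    also have "\<dots> = S / (4 * N)" by (simp add: S_def mult_ac)
    finally show ?thesis by (simp only: N_def of_nat_mult)
  qed
  have \<nu>: "\<mu> \<le> \<nu>" "\<nu> \<le> \<beta>" "257 * \<epsilon> \<le> \<nu> * R\<^sup>2"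
  proof -
    have "\<mu> * K \<le> \<mu> * \<kappa>" using mu by (intro mult_left_mono) (auto simp: K_def)
    then show "\<mu> \<le> \<nu>" using mu K1 by (simp add: \<nu>_def \<kappa>_def field_simps)
    have "\<beta> * 1 \<le> \<beta> * K" using \<beta> K1 by (intro mult_left_mono) auto
    then show "\<nu> \<le> \<beta>" using K1 by (simp add: \<nu>_def field_simps)
    have "K * (257 * \<epsilon>) \<le> Q / 257 * (257 * \<epsilon>)" using eps by (intro mult_right_mono) (auto simp: K_def)
    also have "\<dots> = \<beta> * R\<^sup>2" using eps by (simp add: Q_def)
    finally show "257 * \<epsilon> \<le> \<nu> * R\<^sup>2" using K1 by (simp add: \<nu>_def field_simps)
  qed
  have n: "16 * \<nu> * N * real n \<le> \<beta> - \<nu>"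
  proof -
    have "16 * N * real n \<le> K - 1"
    proof (cases "l = 0")
      case True
      then show ?thesis using K1 by (simp add: n_def)
    next
      case False
      then have l: "48 * real l \<le> sqrt K" unfolding l_def using of_nat_floor[of "sqrt K / 48"] K1 by simp
      then have "(48 * real l)\<^sup>2 \<le> (sqrt K)\<^sup>2" by (intro power_mono) auto
      then have "(48 * real l)\<^sup>2 \<le> K" using K1 by simp
      moreover have "1 \<le> real l" using False by simp
      then have "real l * 1 \<le> real l * real l" by (intro mult_left_mono) auto
      moreover have "16 * N * real n = 64 * (real l * real l) + 32 * real l"
        by (simp add: N_def n_def algebra_simps)
      ultimately show ?thesis using \<open>1 \<le> real l\<close> unfolding power2_eq_square by linarith
    qed
    then have "\<nu> * (16 * N * real n) \<le> \<nu> * (K - 1)" using \<nu> mu by (intro mult_left_mono) auto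
    moreover have "\<nu> * K = \<beta>" using K1 by (simp add: \<nu>_def)
    ultimately show ?thesis by (simp add: algebra_simps)
  qed
  have "Suc l * m \<le> T"
  proof (rule ccontr)
    assume "\<not> Suc l * m \<le> T"
    then have "T < Suc l * m" by simp
    from hard_instance[OF alg R mu(1) \<nu>(1,2) _ this dim[unfolded n_def] k0] n \<delta>
    obtain f where f: "f \<in> obj_class d R \<mu> \<beta>" "\<nu> * R\<^sup>2 / 256 \<le> f (alg_output T q qout f) - f (minimizer d f)"
      unfolding n_def N_def S_def by blast
    with acc[OF f(1)] \<nu>(3) eps(1) show False by linarith
  qed
  then have "real (Suc l * m) \<le> real T" by (rule of_nat_mono)
  moreover have "sqrt M / (17 * 48) * (real d / 8) \<le> real (Suc l) * real m"
  proof (rule mult_mono)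
    \<comment> \<open>The final constant is 6528 = 17 * 48 * 8: 17^2 exceeds the loss 257 between M
      and K, 48 comes from \<open>l\<close>, and 8 from m \<ge> d / 8.\<close>
    have "sqrt M \<le> sqrt (17\<^sup>2 * K)" using KM K1 by (intro real_sqrt_le_mono) simp
    then have "sqrt M \<le> 17 * sqrt K" by (simp add: real_sqrt_mult)
    moreover have "sqrt K / 48 \<le> real (Suc l)" unfolding l_def using K1 by linarith
    ultimately show "sqrt M / (17 * 48) \<le> real (Suc l)" by linarith
  qed (use md in auto)
  ultimately show ?thesis by (simp add: M_def algebra_simps)
qed

subsection \<open>Accelerated projected gradient descent with restarts\<close>

definition proj_n :: "nat \<Rightarrow> real \<Rightarrow> (nat \<Rightarrow> real) \<Rightarrow> nat \<Rightarrow> real" where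
  "proj_n d r w = (if norm_n d w \<le> r then w else (\<lambda>i. r / norm_n d w * w i))"

lemma proj_n_in_cball:
  assumes "w \<in> Rn d" "0 \<le> r"
  shows "proj_n d r w \<in> cball_n d r"
proof (cases "norm_n d w \<le> r")
  case False
  then have "0 < norm_n d w" using assms(2) by linarith
  then have "r / norm_n d w * norm_n d w = r" by simp
  moreover have "\<bar>r / norm_n d w\<bar> = r / norm_n d w" using assms(2) by simp
  ultimately have "norm_n d (\<lambda>i. r / norm_n d w * w i) = r" by (simp only: norm_n_scale)
  then show ?thesis
    using False assms by (simp add: proj_n_def cball_n_iff Rn_iff)
qed (use assms in \<open>simp add: proj_n_def cball_n_iff\<close>)

text \<open>Outside the ball the projection is \<open>a\<close> times \<open>w\<close> with a |w| =
  r, so the product equals (1 - a) (<w, u> - a |w|^2), which Cauchy-Schwarz makes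
  nonpositive.\<close>

lemma proj_n_obtuse:
  assumes u: "u \<in> cball_n d r" and "0 \<le> r"
  shows "inner_n d (w - proj_n d r w) (u - proj_n d r w) \<le> 0"
proof (cases "norm_n d w \<le> r")
  case True
  then show ?thesis by (simp add: proj_n_def inner_n_minus)
next
  case False
  define a where "a = r / norm_n d w"
  have w: "0 < norm_n d w" using False assms(2) by linarith
  have a: "0 \<le> a" "a \<le> 1" "a * norm_n d w = r" using False w assms(2) by (simp_all add: a_def)
  have p: "proj_n d r w = (\<lambda>i. a * w i)" using False by (simp add: proj_n_def a_def)
  have "inner_n d w u \<le> norm_n d w * norm_n d u" using inner_n_Cauchy[of d w u] by linarith
  also have "\<dots> \<le> norm_n d w * r" using u by (intro mult_left_mono) (auto simp: cball_n_iff)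
  finally have "inner_n d w u - a * (norm_n d w)\<^sup>2 \<le> 0" using a(3) by (simp add: power2_eq_square mult.assoc[symmetric] mult.commute)
  then have "(1 - a) * (inner_n d w u - a * (norm_n d w)\<^sup>2) \<le> 0"
    using a by (intro mult_nonneg_nonpos) auto
  also have "(1 - a) * (inner_n d w u - a * (norm_n d w)\<^sup>2) = inner_n d (w - proj_n d r w) (u - proj_n d r w)"
    unfolding p norm_n_sq inner_n_minus inner_n_scale by (simp add: algebra_simps)
  finally show ?thesis .
qed

lemma norm_n_minus_sq:
  "(norm_n d (x - y))\<^sup>2 = inner_n d x x - 2 * inner_n d x y + inner_n d y y"
  by (simp add: norm_n_sq inner_n_minus inner_n_commute)

lemma norm_n_minus_le:
  assumes "x \<in> cball_n d r" "y \<in> cball_n d r"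
  shows "norm_n d (x - y) \<le> 2 * r"
proof -
  have "norm_n d (x - y) \<le> norm_n d (x - (\<lambda>_. 0)) + norm_n d ((\<lambda>_. 0) - y)"
    by (rule norm_n_triangle)
  moreover have "norm_n d (x - (\<lambda>_. 0)) = norm_n d x" "norm_n d ((\<lambda>_. 0) - y) = norm_n d y"
    by (simp_all add: norm_n_def L2_set_def)
  ultimately show ?thesis using assms by (simp add: cball_n_iff)
qed

lemma cball_n_convex:
  assumes "x \<in> cball_n d r" "z \<in> cball_n d r" "0 \<le> t" "t \<le> 1"
  shows "(\<lambda>i. (1 - t) * x i + t * z i) \<in> cball_n d r"
proof -
  have "norm_n d (\<lambda>i. (1 - t) * x i + t * z i) \<le> norm_n d (\<lambda>i. (1 - t) * x i) + norm_n d (\<lambda>i. t * z i)"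
    unfolding norm_n_def by (rule L2_set_triangle_ineq)
  also have "\<dots> = (1 - t) * norm_n d x + t * norm_n d z" using assms by (simp add: norm_n_scale)
  also have "\<dots> \<le> (1 - t) * r + t * r"
    using assms by (intro add_mono mult_left_mono) (auto simp: cball_n_iff)
  finally show ?thesis using assms by (auto simp: cball_n_iff Rn_iff algebra_simps)
qed

text \<open>One step of the method in similar-triangles form. Only \<open>z\<close> is moved and
  projected, and \<open>y\<close> and \<open>x'\<close> are convex combinations, so everything stays
  in the ball. Since x' - y = \<theta> (z' - z), the smoothness error is \<beta> \<theta>^2 |z' -
  z|^2, exactly what the projection inequality gives back. The gradient error is paired with a
  vector no longer than the diameter \<open>2 * r\<close>.\<close>

lemma accelerated_step:
  assumes conv: "\<And>x y. x \<in> Rn d \<Longrightarrow> y \<in> Rn d \<Longrightarrow> f y \<ge> f x + inner_n d (G x) (y - x)"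
    and smooth: "\<And>x y. x \<in> Rn d \<Longrightarrow> y \<in> Rn d \<Longrightarrow>
      f y \<le> f x + inner_n d (G x) (y - x) + \<beta> * (norm_n d (y - x))\<^sup>2"
    and "0 < \<beta>" and \<theta>: "0 < \<theta>" "\<theta> \<le> 1" and "0 \<le> r"
    and x: "x \<in> cball_n d r" and z: "z \<in> cball_n d r" and u: "u \<in> cball_n d r" and g: "g \<in> Rn d"
    and y_def: "y = (\<lambda>i. (1 - \<theta>) * x i + \<theta> * z i)"
    and err: "norm_n d (g - G y) \<le> e"
    and z'_def: "z' = proj_n d r (\<lambda>i. z i - g i / (2 * \<beta> * \<theta>))"
    and x'_def: "x' = (\<lambda>i. (1 - \<theta>) * x i + \<theta> * z' i)"
  shows "f x' - f u \<le> (1 - \<theta>) * (f x - f u) +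
    \<beta> * \<theta>\<^sup>2 * ((norm_n d (z - u))\<^sup>2 - (norm_n d (z' - u))\<^sup>2) + \<theta> * (2 * r * e)"
proof -
  define w where "w = (\<lambda>i. z i - 1 / (2 * \<beta> * \<theta>) * g i)"
  have z': "z' = proj_n d r w" by (simp add: z'_def w_def)
  have "w \<in> Rn d" using z g by (simp add: w_def Rn_iff cball_n_iff)
  then have z'c: "z' \<in> cball_n d r" unfolding z' using \<open>0 \<le> r\<close> by (rule proj_n_in_cball)
  have yc: "y \<in> cball_n d r" unfolding y_def using cball_n_convex[OF x z] \<theta> by simp
  have x'c: "x' \<in> cball_n d r" unfolding x'_def using cball_n_convex[OF x z'c] \<theta> by simp
  have Rn: "x \<in> Rn d" "z \<in> Rn d" "u \<in> Rn d" "y \<in> Rn d" "x' \<in> Rn d" "z' \<in> Rn d"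
    using x z u yc x'c z'c by (simp_all add: cball_n_iff)
  have "x' - y = (\<lambda>i. \<theta> * (z' - z) i)"
    by (simp add: x'_def y_def fun_eq_iff algebra_simps)
  then have step: "(norm_n d (x' - y))\<^sup>2 = \<theta>\<^sup>2 * (norm_n d (z' - z))\<^sup>2"
    using \<theta> by (simp only: norm_n_scale power_mult_distrib)
  have lin: "inner_n d (G y) (x' - y) = (1 - \<theta>) * inner_n d (G y) (x - y) +
      \<theta> * inner_n d (G y) (u - y) + \<theta> * inner_n d (G y) (z' - u)"
  proof -
    have "inner_n d (G y) x' = (1 - \<theta>) * inner_n d (G y) x + \<theta> * inner_n d (G y) z'"
      unfolding x'_def by (simp only: inner_n_linear)
    then show ?thesis by (simp add: inner_n_minus algebra_simps)
  qed
  have "0 \<le> (1 - \<theta>) * (f x - f y - inner_n d (G y) (x - y))"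
    using conv[OF Rn(4,1)] \<theta> by (intro mult_nonneg_nonneg) auto
  moreover have "0 \<le> \<theta> * (f u - f y - inner_n d (G y) (u - y))"
    using conv[OF Rn(4,3)] \<theta> by (intro mult_nonneg_nonneg) auto
  \<comment> \<open>The obtuse angle at \<open>z'\<close>, with the product of differences expanded
    into squared distances (three-point identity), then the passage from \<open>g\<close> to the
    true gradient.\<close>
  moreover have "inner_n d (G y) (z' - u) \<le>
    \<beta> * \<theta> * ((norm_n d (z - u))\<^sup>2 - (norm_n d (z' - u))\<^sup>2 - (norm_n d (z' - z))\<^sup>2) + 2 * r * e"
  proof -
    have "inner_n d (w - z') (u - z') \<le> 0"
      unfolding z' using u \<open>0 \<le> r\<close> by (rule proj_n_obtuse)
    moreover have "inner_n d (w - z') (u - z') =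
        inner_n d (z - z') (u - z') - 1 / (2 * \<beta> * \<theta>) * inner_n d g (u - z')"
      unfolding inner_n_minus(1) w_def inner_n_diff(1) inner_n_scale(1) by simp
    ultimately have "inner_n d (z - z') (u - z') \<le> 1 / (2 * \<beta> * \<theta>) * inner_n d g (u - z')" by simp
    then have "2 * \<beta> * \<theta> * inner_n d (z - z') (u - z') \<le> inner_n d g (u - z')"
      using \<open>0 < \<beta>\<close> \<theta> by (simp add: field_simps)
    moreover have "2 * inner_n d (z - z') (u - z') =
      - ((norm_n d (z - u))\<^sup>2 - (norm_n d (z' - u))\<^sup>2 - (norm_n d (z' - z))\<^sup>2)"
      unfolding norm_n_minus_sq by (simp add: inner_n_minus inner_n_commute)
    then have "2 * \<beta> * \<theta> * inner_n d (z - z') (u - z') =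
      - (\<beta> * \<theta> * ((norm_n d (z - u))\<^sup>2 - (norm_n d (z' - u))\<^sup>2 - (norm_n d (z' - z))\<^sup>2))"
      by algebra
    moreover have "inner_n d g (u - z') = - inner_n d g (z' - u)" by (simp add: inner_n_minus)
    ultimately have 1: "inner_n d g (z' - u) \<le>
      \<beta> * \<theta> * ((norm_n d (z - u))\<^sup>2 - (norm_n d (z' - u))\<^sup>2 - (norm_n d (z' - z))\<^sup>2)" by linarith
    have "- inner_n d (g - G y) (z' - u) \<le> norm_n d (g - G y) * norm_n d (z' - u)"
      using inner_n_Cauchy[of d "g - G y" "z' - u"] by linarith
    also have "\<dots> \<le> e * (2 * r)"
      using err norm_n_minus_le[OF z'c u] norm_n_ge0 order_trans by (intro mult_mono) blast+
    finally have "inner_n d (G y) (z' - u) \<le> inner_n d g (z' - u) + 2 * r * e"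
      by (simp add: inner_n_minus mult_ac)
    with 1 show ?thesis by linarith
  qed
  then have "\<theta> * inner_n d (G y) (z' - u) \<le> \<theta> *
    (\<beta> * \<theta> * ((norm_n d (z - u))\<^sup>2 - (norm_n d (z' - u))\<^sup>2 - (norm_n d (z' - z))\<^sup>2) + 2 * r * e)"
    using \<theta> by (intro mult_left_mono) auto
  moreover have "f x' \<le> f y + inner_n d (G y) (x' - y) + \<beta> * (\<theta>\<^sup>2 * (norm_n d (z' - z))\<^sup>2)"
    using smooth[OF Rn(4,5)] by (simp add: step)
  ultimately show ?thesis unfolding lin by (simp add: algebra_simps power2_eq_square)
qed

text \<open>The gradients enter as a given sequence \<open>g\<close>, which decouples the iteration
  from the way they are obtained. A restart every \<open>L\<close> steps resets \<open>z\<close> to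
  \<open>x\<close> and the weight \<theta> to 1.\<close>

primrec agd :: "nat \<Rightarrow> real \<Rightarrow> real \<Rightarrow> nat \<Rightarrow> (nat \<Rightarrow> nat \<Rightarrow> real) \<Rightarrow> nat \<Rightarrow> (nat \<Rightarrow> real) \<times> (nat \<Rightarrow> real)"
  where
  "agd d r \<beta> L g 0 = (\<lambda>_. 0, \<lambda>_. 0)"
| "agd d r \<beta> L g (Suc t) =
    (let x = fst (agd d r \<beta> L g t);
         z = (if t mod L = 0 then x else snd (agd d r \<beta> L g t));
         \<theta> = 2 / (real (t mod L) + 2);
         z' = proj_n d r (\<lambda>i. z i - g t i / (2 * \<beta> * \<theta>))
     in (\<lambda>i. (1 - \<theta>) * x i + \<theta> * z' i, z'))"

text \<open>The point at which \<open>g t\<close> should approximate the gradient. It depends on the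
  entries of \<open>g\<close> before \<open>t\<close> only, so there is no circularity.\<close>

definition agd_query :: "nat \<Rightarrow> real \<Rightarrow> real \<Rightarrow> nat \<Rightarrow> (nat \<Rightarrow> nat \<Rightarrow> real) \<Rightarrow> nat \<Rightarrow> nat \<Rightarrow> real"
  where
  "agd_query d r \<beta> L g t =
    (let x = fst (agd d r \<beta> L g t);
         z = (if t mod L = 0 then x else snd (agd d r \<beta> L g t));
         \<theta> = 2 / (real (t mod L) + 2)
     in (\<lambda>i. (1 - \<theta>) * x i + \<theta> * z i))"

lemma agd_cong:
  "(\<And>s. s < t \<Longrightarrow> g s = g' s) \<Longrightarrow> agd d r \<beta> L g t = agd d r \<beta> L g' t"
  by (induction t) (simp_all add: Let_def)

lemma agd_query_cong:
  "(\<And>s. s < t \<Longrightarrow> g s = g' s) \<Longrightarrow> agd_query d r \<beta> L g t = agd_query d r \<beta> L g' t"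
  unfolding agd_query_def using agd_cong[of t g g' d r \<beta> L] by (simp add: Let_def)

lemma agd_in_cball:
  assumes "0 \<le> r" "\<And>s. g s \<in> Rn d"
  shows "fst (agd d r \<beta> L g t) \<in> cball_n d r \<and> snd (agd d r \<beta> L g t) \<in> cball_n d r"
proof (induction t)
  case 0
  show ?case using assms(1) by (simp add: cball_n_iff Rn_iff)
next
  case (Suc t)
  define x where "x = fst (agd d r \<beta> L g t)"
  define z where "z = (if t mod L = 0 then x else snd (agd d r \<beta> L g t))"
  define \<theta> where "\<theta> = 2 / (real (t mod L) + 2)"
  define z' where "z' = proj_n d r (\<lambda>i. z i - g t i / (2 * \<beta> * \<theta>))"
  have \<theta>: "0 \<le> \<theta>" "\<theta> \<le> 1" by (simp_all add: \<theta>_def)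
  have xz: "x \<in> cball_n d r" "z \<in> cball_n d r" using Suc by (simp_all add: x_def z_def)
  then have "(\<lambda>i. z i - g t i / (2 * \<beta> * \<theta>)) \<in> Rn d" using assms(2)[of t] by (simp add: cball_n_iff Rn_iff)
  then have "z' \<in> cball_n d r" unfolding z'_def using assms(1) by (rule proj_n_in_cball)
  moreover from this have "(\<lambda>i. (1 - \<theta>) * x i + \<theta> * z' i) \<in> cball_n d r"
    using xz(1) \<theta> by (intro cball_n_convex)
  ultimately show ?case
    by (simp add: Let_def x_def[symmetric] z_def[symmetric] \<theta>_def[symmetric] z'_def[symmetric])
qed

lemma agd_query_in_cball:
  assumes "0 \<le> r" "\<And>s. g s \<in> Rn d"
  shows "agd_query d r \<beta> L g t \<in> cball_n d r"
  unfolding agd_query_def Let_def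
  using agd_in_cball[of r g d \<beta> L t, OF assms] by (intro cball_n_convex) (auto simp: divide_le_eq)

text \<open>Within a restart period the quantity
  \<open>k (k + 2) / 4 * (f x\<^sub>k - f u) + \<beta> * \<parallel>z\<^sub>k - u\<parallel>\<^sup>2\<close> grows only by the gradient errors.\<close>

lemma agd_epoch:
  fixes u :: "nat \<Rightarrow> real" and L j :: nat
  assumes conv: "\<And>x y. x \<in> Rn d \<Longrightarrow> y \<in> Rn d \<Longrightarrow> f y \<ge> f x + inner_n d (G x) (y - x)"
    and smooth: "\<And>x y. x \<in> Rn d \<Longrightarrow> y \<in> Rn d \<Longrightarrow>
      f y \<le> f x + inner_n d (G x) (y - x) + \<beta> * (norm_n d (y - x))\<^sup>2"
    and pos: "0 < \<beta>" "0 \<le> r" "0 \<le> e" "0 < L" and u: "u \<in> cball_n d r"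
    and min: "\<And>x. x \<in> Rn d \<Longrightarrow> f u \<le> f x"
    and g: "\<And>s. g s \<in> Rn d"
    and err: "\<And>k. k < L \<Longrightarrow> norm_n d (g (j * L + k) - G (agd_query d r \<beta> L g (j * L + k))) \<le> e"
  shows "f (fst (agd d r \<beta> L g (Suc j * L))) - f u \<le>
    4 * \<beta> * (norm_n d (fst (agd d r \<beta> L g (j * L)) - u))\<^sup>2 / (real L)\<^sup>2 + 4 * r * e"
proof -
  define X where "X k = fst (agd d r \<beta> L g (j * L + k))" for k
  \<comment> \<open>The case \<open>k = 0\<close> mirrors the reset at a restart, where the stored
    second component is stale.\<close>
  define Z where "Z k = (if k = 0 then X 0 else snd (agd d r \<beta> L g (j * L + k)))" for k
  define A where "A k = f (X k) - f u" for k
  define D where "D k = (norm_n d (Z k - u))\<^sup>2" for k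
  have XZ: "X k \<in> cball_n d r" "Z k \<in> cball_n d r" for k
    using agd_in_cball[of r g d \<beta> L, OF pos(2) g] by (simp_all add: X_def Z_def)
  have A0: "0 \<le> A k" for k using min XZ(1)[of k] by (simp add: A_def cball_n_iff)
  have step: "A (Suc k) * ((real k + 2)\<^sup>2 / 4) \<le> A k * (real k * (real k + 2) / 4) +
      \<beta> * (D k - D (Suc k)) + r * e * (real k + 2)" if k: "k < L" for k
  proof -
    define \<theta> where "\<theta> = 2 / (real k + 2)"
    have \<theta>: "0 < \<theta>" "\<theta> \<le> 1" by (simp_all add: \<theta>_def divide_le_eq)
    have md: "(j * L + k) mod L = k" using k by simp
    define y where "y = (\<lambda>i. (1 - \<theta>) * X k i + \<theta> * Z k i)"
    have y: "y = agd_query d r \<beta> L g (j * L + k)"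
      unfolding agd_query_def Let_def md by (simp add: y_def X_def Z_def \<theta>_def)
    have Z': "Z (Suc k) = proj_n d r (\<lambda>i. Z k i - g (j * L + k) i / (2 * \<beta> * \<theta>))"
      using md by (simp add: Z_def X_def \<theta>_def Let_def)
    have X': "X (Suc k) = (\<lambda>i. (1 - \<theta>) * X k i + \<theta> * Z (Suc k) i)"
      using md by (simp add: Z_def X_def \<theta>_def Let_def)
    have "A (Suc k) \<le> (1 - \<theta>) * A k + \<beta> * \<theta>\<^sup>2 * (D k - D (Suc k)) + \<theta> * (2 * r * e)"
      unfolding A_def D_def
      by (rule accelerated_step[where G = G and g = "g (j * L + k)" and y = y,
            OF conv smooth pos(1) \<theta> pos(2) XZ u g y_def _ Z' X'])
         (use err[OF k] in \<open>simp_all add: y\<close>)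
    \<comment> \<open>Division by \<theta>^2 makes the distance terms telescope.\<close>
    then have "A (Suc k) * (1 / \<theta>\<^sup>2) \<le>
      ((1 - \<theta>) * A k + \<beta> * \<theta>\<^sup>2 * (D k - D (Suc k)) + \<theta> * (2 * r * e)) * (1 / \<theta>\<^sup>2)"
      by (intro mult_right_mono) auto
    also have "\<dots> = A k * ((1 - \<theta>) / \<theta>\<^sup>2) + \<beta> * (D k - D (Suc k)) + 2 * r * e / \<theta>"
      using \<theta> by (simp add: field_simps power2_eq_square)
    also have "1 / \<theta>\<^sup>2 = (real k + 2)\<^sup>2 / 4" by (simp add: \<theta>_def power_divide)
    also have "(1 - \<theta>) / \<theta>\<^sup>2 = real k * (real k + 2) / 4"
    proof -
      have "1 - \<theta> = real k / (real k + 2)" by (simp add: \<theta>_def field_simps)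
      then show ?thesis by (simp add: \<theta>_def power_divide power2_eq_square)
    qed
    also have "2 * r * e / \<theta> = r * e * (real k + 2)" by (simp add: \<theta>_def)
    finally show ?thesis .
  qed
  have main: "A k * (real k * (real k + 2) / 4) + \<beta> * D k \<le> \<beta> * D 0 + r * e * (real k * (real k + 1))"
    if "k \<le> L" for k
    using that
  proof (induction k)
    case (Suc k)
    \<comment> \<open>The weights fit together because (k + 1)(k + 3) \<le> (k + 2)^2.\<close>
    have "A (Suc k) * (real (Suc k) * (real (Suc k) + 2) / 4) \<le> A (Suc k) * ((real k + 2)\<^sup>2 / 4)"
      by (intro mult_left_mono A0) (simp add: power2_eq_square algebra_simps)
    moreover have "r * e * (real k * (real k + 1)) + r * e * (real k + 2) \<le> r * e * (real (Suc k) * (real (Suc k) + 1))"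
      unfolding distrib_left[symmetric] using pos by (intro mult_left_mono) (auto simp: algebra_simps)
    moreover have "\<beta> * (D k - D (Suc k)) = \<beta> * D k - \<beta> * D (Suc k)" by (rule right_diff_distrib)
    ultimately show ?case using Suc.IH Suc.prems step[of k] by linarith
  qed simp
  have L: "0 < real L" using pos by simp
  have "A L * (real L * (real L + 2) / 4) \<le> \<beta> * D 0 + r * e * (real L * (real L + 1))"
  proof -
    have "0 \<le> \<beta> * D L" using pos by (simp add: D_def)
    then show ?thesis using main[of L] by linarith
  qed
  moreover have "A L * ((real L)\<^sup>2 / 4) + A L * (real L / 2) = A L * (real L * (real L + 2) / 4)"
    by (simp add: power2_eq_square algebra_simps)
  moreover have "(4 * \<beta> * D 0 / (real L)\<^sup>2 + 4 * r * e) * (real L * (real L + 2) / 4) \<ge> \<beta> * D 0 + r * e * (real L * (real L + 1))"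
  proof -
    have "0 \<le> \<beta> * D 0" using pos by (simp add: D_def)
    then have "\<beta> * D 0 * 1 \<le> \<beta> * D 0 * ((real L + 2) / real L)" using L by (intro mult_left_mono) auto
    then have "\<beta> * D 0 \<le> 4 * \<beta> * D 0 / (real L)\<^sup>2 * (real L * (real L + 2) / 4)"
      using L by (simp add: power2_eq_square)
    moreover have "r * e * (real L * (real L + 1)) \<le> r * e * (real L * (real L + 2))"
      using pos by (intro mult_left_mono) auto
    ultimately show ?thesis by (simp add: distrib_right)
  qed
  ultimately have "A L * (real L * (real L + 2) / 4) \<le>
      (4 * \<beta> * D 0 / (real L)\<^sup>2 + 4 * r * e) * (real L * (real L + 2) / 4)" by linarith
  moreover have "0 < real L * (real L + 2) / 4" using L by simp
  ultimately have "A L \<le> 4 * \<beta> * D 0 / (real L)\<^sup>2 + 4 * r * e"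
    by (rule mult_right_le_imp_le)
  then show ?thesis by (simp add: A_def D_def X_def Z_def add.commute)
qed

text \<open>Quadratic growth bounds the squared distance at a restart by 2 / \<mu> times the gap, so
  a period with \<open>16 * \<beta> \<le> \<mu> * (real L)\<^sup>2\<close> halves the gap up to an
  error \<open>4 * r * e\<close>; these errors sum geometrically to at most
  \<open>8 * r * e\<close>. The first period starts from the diameter bound instead, and with
  \<open>J = 0\<close> it is the only one.\<close>

lemma agd_converges:
  fixes L J :: nat
  assumes conv: "\<And>x y. x \<in> Rn d \<Longrightarrow> y \<in> Rn d \<Longrightarrow>
      f y \<ge> f x + inner_n d (G x) (y - x) + \<mu> / 2 * (norm_n d (y - x))\<^sup>2"
    and lip: "\<And>x y. x \<in> Rn d \<Longrightarrow> y \<in> Rn d \<Longrightarrow> norm_n d (G x - G y) \<le> \<beta> * norm_n d (x - y)"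
    and pos: "0 < \<mu>" "0 < \<beta>" "0 \<le> r" "0 \<le> e" "0 < L" and u: "u \<in> cball_n d r"
    and Gu: "\<And>x. x \<in> Rn d \<Longrightarrow> f u + \<mu> / 2 * (norm_n d (x - u))\<^sup>2 \<le> f x"
    and g: "\<And>s. g s \<in> Rn d"
    and err: "\<And>s. s < Suc J * L \<Longrightarrow> norm_n d (g s - G (agd_query d r \<beta> L g s)) \<le> e"
    and L: "J = 0 \<or> 16 * \<beta> \<le> \<mu> * (real L)\<^sup>2"
  shows "f (fst (agd d r \<beta> L g (Suc J * L))) - f u \<le> 16 * \<beta> * r\<^sup>2 / (real L)\<^sup>2 / 2 ^ J + 8 * r * e"
proof -
  have conv0: "f y \<ge> f x + inner_n d (G x) (y - x)" if "x \<in> Rn d" "y \<in> Rn d" for x y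
  proof -
    have "0 \<le> \<mu> / 2 * (norm_n d (y - x))\<^sup>2" using pos by simp
    with conv[OF that] show ?thesis by linarith
  qed
  note smooth = smooth_upper_bound[of d f G \<beta>, OF conv0 lip]
  have min: "f u \<le> f x" if "x \<in> Rn d" for x
  proof -
    have "0 \<le> \<mu> / 2 * (norm_n d (x - u))\<^sup>2" using pos by simp
    with Gu[OF that] show ?thesis by linarith
  qed
  define \<Delta> where "\<Delta> j = f (fst (agd d r \<beta> L g (j * L))) - f u" for j
  define D where "D j = (norm_n d (fst (agd d r \<beta> L g (j * L)) - u))\<^sup>2" for j
  have ball: "fst (agd d r \<beta> L g t) \<in> cball_n d r" for t
    using agd_in_cball[of r g d, OF pos(3) g] by blast
  have epoch: "\<Delta> (Suc j) \<le> 4 * \<beta> * D j / (real L)\<^sup>2 + 4 * r * e" if "j \<le> J" for j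
    unfolding \<Delta>_def D_def
  proof (rule agd_epoch[where G = G, OF conv0 smooth pos(2-5) u min g])
    fix k assume "k < L"
    then have "j * L + k < Suc j * L" by simp
    also have "\<dots> \<le> Suc J * L" using that by (intro mult_right_mono) auto
    finally show "norm_n d (g (j * L + k) - G (agd_query d r \<beta> L g (j * L + k))) \<le> e" by (rule err)
  qed
  have "\<Delta> (Suc j) \<le> 16 * \<beta> * r\<^sup>2 / (real L)\<^sup>2 / 2 ^ j + 8 * r * e" if "j \<le> J" for j
    using that
  proof (induction j)
    case 0
    have "D 0 \<le> (2 * r)\<^sup>2" unfolding D_def
      by (intro power_mono norm_n_minus_le[OF ball u] norm_n_ge0)
    then have "4 * \<beta> * D 0 / (real L)\<^sup>2 \<le> 4 * \<beta> * (2 * r)\<^sup>2 / (real L)\<^sup>2"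
      using pos by (intro divide_right_mono mult_left_mono) auto
    then have "4 * \<beta> * D 0 / (real L)\<^sup>2 \<le> 16 * \<beta> * r\<^sup>2 / (real L)\<^sup>2" by (simp add: power_mult_distrib)
    moreover have "0 \<le> r * e" using pos by simp
    ultimately show ?case using epoch[of 0] by simp
  next
    case (Suc j)
    then have "J \<noteq> 0" by simp
    with L have L16: "16 * \<beta> \<le> \<mu> * (real L)\<^sup>2" by blast
    have L0: "0 < (real L)\<^sup>2" using pos by simp
    have "0 \<le> D (Suc j)" by (simp add: D_def)
    then have "16 * \<beta> * D (Suc j) \<le> \<mu> * (real L)\<^sup>2 * D (Suc j)" using L16 by (rule mult_right_mono[rotated])
    then have "4 * \<beta> * D (Suc j) / (real L)\<^sup>2 \<le> \<mu> / 4 * D (Suc j)" using L0 by (simp add: field_simps)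
    moreover have "\<mu> / 2 * D (Suc j) \<le> \<Delta> (Suc j)"
      using Gu[of "fst (agd d r \<beta> L g (Suc j * L))"] ball by (simp add: D_def \<Delta>_def cball_n_iff)
    ultimately have "\<Delta> (Suc (Suc j)) \<le> \<Delta> (Suc j) / 2 + 4 * r * e" using epoch[OF Suc.prems] by linarith
    also have "\<dots> \<le> (16 * \<beta> * r\<^sup>2 / (real L)\<^sup>2 / 2 ^ j + 8 * r * e) / 2 + 4 * r * e" using Suc by simp
    also have "\<dots> = 16 * \<beta> * r\<^sup>2 / (real L)\<^sup>2 / 2 ^ Suc j + 8 * r * e"
      by (simp add: add_divide_distrib)
    finally show ?case .
  qed
  from this[of J] show ?thesis by (simp add: \<Delta>_def)
qed

subsection \<open>Gradients from function values\<close>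

text \<open>The transcript is cut into blocks of \<open>d + 1\<close> values: offset 0 holds the
  base value, offset \<open>Suc i\<close> the value after a shift along coordinate
  \<open>i\<close>.\<close>

definition grad_est :: "nat \<Rightarrow> real \<Rightarrow> transcript \<Rightarrow> nat \<Rightarrow> nat \<Rightarrow> real" where
  "grad_est d h w t i =
    (if i < d then (snd (w (t * Suc d + Suc i)) - snd (w (t * Suc d))) / h else 0)"

text \<open>The base point is recomputed from the estimates of all completed blocks, so the
  transcript is the only memory. At offset 0 no coordinate is shifted.\<close>

definition fd_query :: "nat \<Rightarrow> real \<Rightarrow> real \<Rightarrow> nat \<Rightarrow> real \<Rightarrow> nat \<Rightarrow> transcript \<Rightarrow> nat \<Rightarrow> real" where
  "fd_query d r \<beta> L h s w j = agd_query d r \<beta> L (grad_est d h w) (s div Suc d) j +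
     (if s mod Suc d = Suc j then h else 0)"

lemma grad_est_Rn: "grad_est d h w t \<in> Rn d"
  by (simp add: grad_est_def Rn_iff)

text \<open>The iterates are confined to half of the allowed radius, where the minimizer lies too;
  this leaves room for the finite difference step.\<close>

lemma fd_query_in_cball:
  assumes "0 \<le> r" "0 \<le> h" "h \<le> r"
  shows "fd_query d r \<beta> L h s w \<in> cball_n d (2 * r)"
proof -
  define y where "y = agd_query d r \<beta> L (grad_est d h w) (s div Suc d)"
  define e where "e j = (if s mod Suc d = Suc j then h else 0)" for j
  have y: "y \<in> cball_n d r"
    unfolding y_def by (intro agd_query_in_cball assms grad_est_Rn)
  have e0: "e j = 0" if "d \<le> j" for j
  proof -
    have "s mod Suc d < Suc d" by (rule mod_less_divisor) simp
    with that have "s mod Suc d \<noteq> Suc j" by linarith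
    then show ?thesis by (simp add: e_def)
  qed
  have eq: "fd_query d r \<beta> L h s w = (\<lambda>j. y j + e j)"
    by (simp add: fun_eq_iff fd_query_def y_def e_def)
  have "norm_n d e \<le> h"
  proof -
    have "norm_n d e \<le> (\<Sum>j<d. \<bar>e j\<bar>)" unfolding norm_n_def by (rule L2_set_le_sum_abs)
    also have "\<dots> = (\<Sum>j<d. if j = s mod Suc d - 1 then \<bar>e j\<bar> else 0)"
      by (intro sum.cong) (auto simp: e_def)
    also have "\<dots> \<le> h" using assms by (auto simp: sum.delta e_def)
    finally show ?thesis .
  qed
  moreover have "norm_n d (\<lambda>j. y j + e j) \<le> norm_n d y + norm_n d e"
    unfolding norm_n_def by (rule L2_set_triangle_ineq)
  ultimately show ?thesis using y assms e0 by (auto simp: eq cball_n_iff Rn_iff)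
qed

text \<open>Convexity and smoothness place \<open>f (y + h e\<^sub>i) - f y - h * G y i\<close>
  between 0 and \<beta> h^2, so each coordinate is off by at most \<beta> h; the Euclidean norm is
  bounded by the sum of the coordinates.\<close>

lemma forward_difference_error:
  assumes Rn: "\<And>x. x \<in> Rn d \<Longrightarrow> G x \<in> Rn d"
    and conv: "\<And>x y. x \<in> Rn d \<Longrightarrow> y \<in> Rn d \<Longrightarrow> f y \<ge> f x + inner_n d (G x) (y - x)"
    and smooth: "\<And>x y. x \<in> Rn d \<Longrightarrow> y \<in> Rn d \<Longrightarrow>
      f y \<le> f x + inner_n d (G x) (y - x) + \<beta> * (norm_n d (y - x))\<^sup>2"
    and y: "y \<in> Rn d" and "0 < h" and g: "g \<in> Rn d"
    and g_eq: "\<And>i. i < d \<Longrightarrow> g i = (f (\<lambda>j. y j + (if j = i then h else 0)) - f y) / h"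
  shows "norm_n d (g - G y) \<le> real d * (\<beta> * h)"
proof -
  have "\<bar>(g - G y) i\<bar> \<le> \<beta> * h" if i: "i < d" for i
  proof -
    define y' where "y' = (\<lambda>j. y j + (if j = i then h else 0))"
    have y': "y' \<in> Rn d" using y i by (auto simp: y'_def Rn_iff)
    have "inner_n d (G y) (y' - y) = (\<Sum>j<d. if j = i then G y j * h else 0)"
      unfolding inner_n_def by (intro sum.cong) (auto simp: y'_def)
    also have "\<dots> = G y i * h" using i by (simp add: sum.delta)
    finally have in_eq: "inner_n d (G y) (y' - y) = G y i * h" .
    have "inner_n d (y' - y) (y' - y) = (\<Sum>j<d. if j = i then h * h else 0)"
      unfolding inner_n_def by (intro sum.cong) (auto simp: y'_def)
    also have "\<dots> = h * h" using i by (simp add: sum.delta)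
    finally have "(norm_n d (y' - y))\<^sup>2 = h * h" by (simp add: norm_n_sq)
    then have "0 \<le> f y' - f y - G y i * h" "f y' - f y - G y i * h \<le> \<beta> * (h * h)"
      using conv[OF y y'] smooth[OF y y'] in_eq by simp_all
    moreover have "(g i - G y i) * h = f y' - f y - G y i * h"
      unfolding left_diff_distrib g_eq[OF i] y'_def[symmetric] using \<open>0 < h\<close> by simp
    ultimately have "0 \<le> (g i - G y i) * h" "(g i - G y i) * h \<le> (\<beta> * h) * h" by simp_all
    then show ?thesis using \<open>0 < h\<close> by (simp add: zero_le_mult_iff)
  qed
  then have "(\<Sum>i<d. \<bar>(g - G y) i\<bar>) \<le> real (card {..<d}) * (\<beta> * h)"
    by (intro sum_bounded_above) auto
  moreover have "norm_n d (g - G y) \<le> (\<Sum>i<d. \<bar>(g - G y) i\<bar>)"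
    unfolding norm_n_def by (rule L2_set_le_sum_abs)
  ultimately show ?thesis by simp
qed

lemma grad_est_cong:
  assumes "\<And>s. s < Suc t * Suc d \<Longrightarrow> w s = w' s"
  shows "grad_est d h w t = grad_est d h w' t"
proof
  fix i
  have "t * Suc d + Suc i < Suc t * Suc d" if "i < d" using that by simp
  moreover have "t * Suc d < Suc t * Suc d" by simp
  ultimately show "grad_est d h w t i = grad_est d h w' t i"
    using assms by (simp add: grad_est_def del: mult_Suc mult_Suc_right)
qed

text \<open>Causality: query \<open>s\<close> reads only blocks completed before \<open>s\<close>.
  The final transcript may therefore replace the partial ones, and the whole run is analysed with a
  single sequence of estimates.\<close>

lemma fd_query_cong:
  assumes "\<And>k. k < s \<Longrightarrow> w k = w' k"
  shows "fd_query d r \<beta> L h s w = fd_query d r \<beta> L h s w'"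
proof -
  have "grad_est d h w t = grad_est d h w' t" if "t < s div Suc d" for t
  proof (rule grad_est_cong)
    fix k assume "k < Suc t * Suc d"
    also have "\<dots> \<le> s div Suc d * Suc d" using that by (intro mult_right_mono) auto
    also have "\<dots> \<le> s" by (rule div_times_less_eq_dividend)
    finally show "w k = w' k" by (rule assms)
  qed
  then have "agd_query d r \<beta> L (grad_est d h w) (s div Suc d) = agd_query d r \<beta> L (grad_est d h w') (s div Suc d)"
    by (rule agd_query_cong)
  then show ?thesis by (simp add: fun_eq_iff fd_query_def)
qed

lemma transcript_of_nth:
  "s < t \<Longrightarrow> transcript_of q f t s = (q s (transcript_of q f s), f (q s (transcript_of q f s)))"
  by (induction t) (auto simp: Let_def less_Suc_eq)

lemma fd_transcript:
  assumes "s < t"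
  shows "transcript_of (fd_query d r \<beta> L h) f t s =
    (let x = fd_query d r \<beta> L h s (transcript_of (fd_query d r \<beta> L h) f t) in (x, f x))"
proof -
  have "fd_query d r \<beta> L h s (transcript_of (fd_query d r \<beta> L h) f s) =
      fd_query d r \<beta> L h s (transcript_of (fd_query d r \<beta> L h) f t)"
    using assms by (intro fd_query_cong) (simp add: transcript_of_nth)
  then show ?thesis using transcript_of_nth[OF assms, of "fd_query d r \<beta> L h" f] by (simp add: Let_def)
qed

text \<open>The run of the algorithm is thus \<open>agd\<close> driven by the forward differences at
  its own query points.\<close>

lemma grad_est_transcript:
  fixes d r \<beta> L h f n
  defines "w \<equiv> transcript_of (fd_query d r \<beta> L h) f (n * Suc d)"
  defines "y \<equiv> agd_query d r \<beta> L (grad_est d h w)"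
  assumes "t < n" "i < d"
  shows "grad_est d h w t i = (f (\<lambda>j. y t j + (if j = i then h else 0)) - f (y t)) / h"
proof -
  have "Suc t * Suc d \<le> n * Suc d" using assms(3) by (intro mult_right_mono) auto
  then have "t * Suc d < n * Suc d" "t * Suc d + Suc i < n * Suc d" using assms(4) by simp_all
  then have "snd (w (t * Suc d)) = f (fd_query d r \<beta> L h (t * Suc d) w)"
    "snd (w (t * Suc d + Suc i)) = f (fd_query d r \<beta> L h (t * Suc d + Suc i) w)"
    unfolding w_def by (simp_all only: fd_transcript Let_def snd_conv)
  moreover have "fd_query d r \<beta> L h (t * Suc d) w = y t"
    by (simp add: fun_eq_iff fd_query_def y_def del: mult_Suc_right)
  moreover have "fd_query d r \<beta> L h (t * Suc d + Suc i) w = (\<lambda>j. y t j + (if j = i then h else 0))"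
  proof -
    have "(t * Suc d + Suc i) div Suc d = t" "(t * Suc d + Suc i) mod Suc d = Suc i"
      using assms(4) div_nat_eqI[of "Suc d" t "t * Suc d + Suc i"] by (simp_all only: mod_mult_self3) (simp_all add: algebra_simps)
    then show ?thesis by (auto simp: fun_eq_iff fd_query_def y_def simp del: mult_Suc_right)
  qed
  ultimately show ?thesis using assms(4) by (simp add: grad_est_def)
qed

section \<open>Borel measurability of the algorithm\<close>

lemma norm_n_measurable:
  assumes "\<And>i. (\<lambda>w. X w i) \<in> borel_measurable M"
  shows "(\<lambda>w. norm_n d (X w)) \<in> borel_measurable M"
  unfolding norm_n_def L2_set_def using assms by measurable

lemma proj_n_measurable:
  assumes "\<And>i. (\<lambda>w. X w i) \<in> borel_measurable M"
  shows "(\<lambda>w. proj_n d r (X w) i) \<in> borel_measurable M"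
proof -
  have [measurable]: "(\<lambda>w. norm_n d (X w)) \<in> borel_measurable M" "(\<lambda>w. X w i) \<in> borel_measurable M"
    using assms by (simp_all add: norm_n_measurable)
  have "(\<lambda>w. if norm_n d (X w) \<le> r then X w i else r / norm_n d (X w) * X w i) \<in> borel_measurable M"
    by measurable
  then show ?thesis by (simp add: proj_n_def if_distrib[of "\<lambda>f. f i"])
qed

lemma agd_measurable:
  assumes "\<And>s i. s < t \<Longrightarrow> (\<lambda>w. g w s i) \<in> borel_measurable M"
  shows "(\<lambda>w. fst (agd d r \<beta> L (g w) t) i) \<in> borel_measurable M"
    "(\<lambda>w. snd (agd d r \<beta> L (g w) t) i) \<in> borel_measurable M"
proof -
  have "(\<forall>i. (\<lambda>w. fst (agd d r \<beta> L (g w) t) i) \<in> borel_measurable M) \<and>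
    (\<forall>i. (\<lambda>w. snd (agd d r \<beta> L (g w) t) i) \<in> borel_measurable M)"
    using assms
  proof (induction t)
    case (Suc t)
    define X where "X w = fst (agd d r \<beta> L (g w) t)" for w
    define Z where "Z w = (if t mod L = 0 then X w else snd (agd d r \<beta> L (g w) t))" for w
    define \<theta> where "\<theta> = 2 / (real (t mod L) + 2)"
    define Z' where "Z' w = proj_n d r (\<lambda>i. Z w i - g w t i / (2 * \<beta> * \<theta>))" for w
    have XZ [measurable]: "(\<lambda>w. X w i) \<in> borel_measurable M" "(\<lambda>w. Z w i) \<in> borel_measurable M" for i
      using Suc by (cases "t mod L = 0"; simp add: X_def Z_def)+
    have [measurable]: "(\<lambda>w. g w t i) \<in> borel_measurable M" for i using Suc.prems by simp
    have [measurable]: "(\<lambda>w. Z' w i) \<in> borel_measurable M" for i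
      unfolding Z'_def by (rule proj_n_measurable) measurable
    have "(\<lambda>w. (1 - \<theta>) * X w i + \<theta> * Z' w i) \<in> borel_measurable M" for i by measurable
    moreover have "agd d r \<beta> L (g w) (Suc t) = (\<lambda>i. (1 - \<theta>) * X w i + \<theta> * Z' w i, Z' w)" for w
      by (simp add: Let_def X_def Z_def Z'_def \<theta>_def)
    ultimately show ?case by simp
  qed simp
  then show "(\<lambda>w. fst (agd d r \<beta> L (g w) t) i) \<in> borel_measurable M"
    "(\<lambda>w. snd (agd d r \<beta> L (g w) t) i) \<in> borel_measurable M" by blast+
qed

lemma transcript_value_measurable:
  "s < n \<Longrightarrow> (\<lambda>w. snd (w s)) \<in> borel_measurable (transcript_space d R n)"
  unfolding transcript_space_def by measurable

lemma grad_est_measurable: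
  assumes "Suc t * Suc d \<le> n"
  shows "(\<lambda>w. grad_est d h w t i) \<in> borel_measurable (transcript_space d' R n)"
proof (cases "i < d")
  case True
  then have "t * Suc d < n" "t * Suc d + Suc i < n" using assms by simp_all
  note [measurable] = this[THEN transcript_value_measurable]
  show ?thesis using True unfolding grad_est_def by measurable
qed (simp add: grad_est_def)

lemma measurable_ball_borelI:
  assumes "\<And>w. X w \<in> cball_n d R" "\<And>i. (\<lambda>w. X w i) \<in> borel_measurable M"
  shows "X \<in> M \<rightarrow>\<^sub>M ball_borel d R"
  unfolding ball_borel_def using assms
  by (intro measurable_restrict_space2 measurable_coordinatewise_then_product) auto

lemma fd_is_algorithm:
  assumes "0 \<le> r" "0 \<le> h" "h \<le> r"
  shows "is_algorithm d (2 * r) (n * Suc d) (fd_query d r \<beta> L h)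
    (\<lambda>w. fst (agd d r \<beta> L (grad_est d h w) n))"
  unfolding is_algorithm_def
proof (intro conjI allI impI measurable_ball_borelI)
  show "fd_query d r \<beta> L h t w \<in> cball_n d (2 * r)" for t w
    by (rule fd_query_in_cball[OF assms])
  show "(\<lambda>w. fd_query d r \<beta> L h t w i) \<in> borel_measurable (transcript_space d (2 * r) t)" for t i
  proof -
    define k where "k = t div Suc d"
    have "(\<lambda>w. grad_est d h w s i) \<in> borel_measurable (transcript_space d (2 * r) t)" if "s < k" for s i
    proof (rule grad_est_measurable)
      have "Suc s * Suc d \<le> k * Suc d" using that by (intro mult_right_mono) auto
      also have "\<dots> \<le> t" unfolding k_def by (rule div_times_less_eq_dividend)
      finally show "Suc s * Suc d \<le> t" .
    qed
    note [measurable] = agd_measurable[of k "grad_est d h", OF this]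
    show ?thesis
      unfolding fd_query_def agd_query_def Let_def k_def[symmetric] by (cases "k mod L = 0") simp_all
  qed
  have "fst (agd d r \<beta> L (grad_est d h w) n) \<in> cball_n d r" for w
    using agd_in_cball[OF assms(1), of "grad_est d h w"] grad_est_Rn by blast
  then show "fst (agd d r \<beta> L (grad_est d h w) n) \<in> cball_n d (2 * r)" for w
    using assms(1) by (auto simp: cball_n_iff intro: order_trans[of _ r])
  show "(\<lambda>w. fst (agd d r \<beta> L (grad_est d h w) n) i) \<in> borel_measurable (transcript_space d (2 * r) (n * Suc d))" for i
  proof (rule agd_measurable, rule grad_est_measurable)
    fix s assume "s < n"
    then show "Suc s * Suc d \<le> n * Suc d" by (intro mult_right_mono) auto
  qed
qed

text \<open>Strong convexity at the midpoint of \<open>u\<close> and \<open>x\<close>: the two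
  linear terms cancel, so the gradient at \<open>u\<close> never has to be identified. The price is
  \<mu> / 4 in place of \<mu> / 2.\<close>

lemma quadratic_growth_at_minimizer:
  assumes conv: "\<And>x y. x \<in> Rn d \<Longrightarrow> y \<in> Rn d \<Longrightarrow>
      f y \<ge> f x + inner_n d (G x) (y - x) + \<mu> / 2 * (norm_n d (y - x))\<^sup>2"
    and u: "u \<in> Rn d" and min: "\<And>x. x \<in> Rn d \<Longrightarrow> f u \<le> f x" and x: "x \<in> Rn d"
  shows "f u + \<mu> / 4 * (norm_n d (x - u))\<^sup>2 \<le> f x"
proof -
  define p where "p = (\<lambda>i. (u i + x i) / 2)"
  have p: "p \<in> Rn d" using u x by (simp add: p_def Rn_iff)
  have "x - p = (\<lambda>i. 1 / 2 * (x - u) i)" "u - p = (\<lambda>i. - 1 / 2 * (x - u) i)"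
    by (simp_all add: p_def fun_eq_iff field_simps)
  then have n: "norm_n d (x - p) = 1 / 2 * norm_n d (x - u)" "norm_n d (u - p) = 1 / 2 * norm_n d (x - u)"
    and "inner_n d (G p) (x - p) + inner_n d (G p) (u - p) = 0"
    by (simp_all only: norm_n_scale inner_n_scale)
  moreover have "\<mu> / 2 * (1 / 2 * norm_n d (x - u))\<^sup>2 = \<mu> / 8 * (norm_n d (x - u))\<^sup>2"
    by (simp add: power_divide)
  ultimately show ?thesis
    using conv[OF p x] conv[OF p u] min[OF p] unfolding n by linarith
qed

lemma query_count_upper:
  fixes d :: nat and R \<mu> \<beta> \<epsilon> :: real
  defines "Q \<equiv> \<beta> * R\<^sup>2 / \<epsilon>" and "\<kappa> \<equiv> \<beta> / \<mu>"
  assumes d: "1 \<le> d" and R: "0 < R" and mu: "0 < \<mu>" "\<mu> \<le> \<beta>" and eps: "0 < \<epsilon>" "\<epsilon> \<le> \<beta> * R\<^sup>2"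
  shows "\<exists>T q qout. is_algorithm d R T q qout \<and>
    (\<forall>f\<in>obj_class d R \<mu> \<beta>. f (alg_output T q qout f) - f (minimizer d f) \<le> \<epsilon>) \<and>
    real T \<le> 28 * real d * sqrt (min Q \<kappa>) * (1 + log_plus (Q / \<kappa>))"
proof -
  define M where "M = min Q \<kappa>"
  \<comment> \<open>The restart condition with modulus \<mu> / 2 asks for L^2 \<ge> 32 \<kappa> when
    M = \<kappa>, and 36 suffices. The accuracy after the last period only needs L^2 \<ge> 8
    M.\<close>
  define L where "L = nat \<lceil>6 * sqrt M\<rceil>"
  define J where "J = nat \<lceil>log 2 (max 1 (Q / \<kappa>))\<rceil>"
  define r where "r = R / 2"
  \<comment> \<open>The accumulated gradient error \<open>8 * r * e\<close> then uses up half of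
    \<epsilon>, and \<open>h\<close> is small enough for this accuracy.\<close>
  define e where "e = \<epsilon> / (8 * R)"
  define h where "h = min r (e / (real d * \<beta>))"
  define T where "T = (Suc J * L) * Suc d"
  define q where "q = fd_query d r \<beta> L h"
  define qout where "qout = (\<lambda>w. fst (agd d r \<beta> L (grad_est d h w) (Suc J * L)))"
  have \<beta>: "0 < \<beta>" using mu by linarith
  have r: "0 < r" "2 * r = R" using R by (simp_all add: r_def)
  have e: "0 < e" using eps R by (simp add: e_def)
  have h: "0 < h" "h \<le> r" using r e d \<beta> by (simp_all add: h_def)
  have he: "real d * (\<beta> * h) \<le> e"
  proof -
    have "real d * \<beta> * h \<le> real d * \<beta> * (e / (real d * \<beta>))"
      using d \<beta> by (intro mult_left_mono) (auto simp: h_def)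
    then show ?thesis using d \<beta> by (simp add: mult.assoc)
  qed
  have Q1: "1 \<le> Q" using eps by (simp add: Q_def)
  have \<kappa>1: "1 \<le> \<kappa>" using mu by (simp add: \<kappa>_def)
  have M1: "1 \<le> M" using Q1 \<kappa>1 by (simp add: M_def)
  then have sM: "1 \<le> sqrt M" by simp
  have L: "6 * sqrt M \<le> real L" "real L \<le> 7 * sqrt M" using sM unfolding L_def by linarith+
  have L36: "36 * M \<le> (real L)\<^sup>2"
  proof -
    have "(6 * sqrt M)\<^sup>2 \<le> (real L)\<^sup>2" using L sM by (intro power_mono) auto
    then show ?thesis using M1 by (simp add: power_mult_distrib)
  qed
  have L0: "0 < L" using L sM by (intro Nat.gr0I) simp
  have J_ge: "Q / \<kappa> \<le> 2 ^ J"
  proof -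
    have "log 2 (max 1 (Q / \<kappa>)) \<le> real J" unfolding J_def by linarith
    then have "max 1 (Q / \<kappa>) \<le> 2 powr real J" by (subst (asm) log_le_iff) auto
    then show ?thesis by (simp add: powr_realpow)
  qed
  have J_le: "real J \<le> 1 + 2 * log_plus (Q / \<kappa>)"
  proof -
    have ln_max: "ln (max 1 (Q / \<kappa>)) = log_plus (Q / \<kappa>)"
      using Q1 \<kappa>1 by (auto simp: log_plus_def max_def)
    have lp: "0 \<le> log_plus (Q / \<kappa>)" by (simp add: log_plus_def)
    have "1 / 2 \<le> ln (2::real)" using ln_ge_iff[of 2 "1/2"] exp_half_le2 by simp
    then have "log_plus (Q / \<kappa>) / ln 2 \<le> log_plus (Q / \<kappa>) / (1 / 2)" using lp by (intro divide_left_mono) auto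
    moreover have "real J \<le> 1 + log 2 (max 1 (Q / \<kappa>))"
    proof -
      have "0 \<le> log 2 (max 1 (Q / \<kappa>))" by simp
      then show ?thesis unfolding J_def by linarith
    qed
    ultimately show ?thesis by (simp add: log_def ln_max)
  qed
  \<comment> \<open>Restarts occur only when \<kappa> is the minimum, where \<open>L\<close> is long
    enough for halving.\<close>
  have JM: "J = 0 \<or> M = \<kappa>"
  proof (cases "Q \<le> \<kappa>")
    case True
    then have "Q / \<kappa> \<le> 1" using \<kappa>1 by simp
    then show ?thesis by (simp add: J_def max_def)
  qed (simp add: M_def)
  have QM: "Q \<le> M * 2 ^ J"
  proof (cases "Q \<le> \<kappa>")
    case True
    then have "M * 1 \<le> M * 2 ^ J" using M1 by (intro mult_left_mono) auto
    then show ?thesis using True by (simp add: M_def)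
  next
    case False
    then show ?thesis using J_ge \<kappa>1 by (simp add: M_def field_simps)
  qed
  have alg: "is_algorithm d R T q qout"
    unfolding T_def q_def qout_def r(2)[symmetric] using r h by (intro fd_is_algorithm) auto
  moreover have "f (alg_output T q qout f) - f (minimizer d f) \<le> \<epsilon>" if f: "f \<in> obj_class d R \<mu> \<beta>" for f
  proof -
    obtain G where G: "\<And>x. x \<in> Rn d \<Longrightarrow> has_gradient d f (G x) x"
      and conv: "\<And>x y. x \<in> Rn d \<Longrightarrow> y \<in> Rn d \<Longrightarrow>
        f y \<ge> f x + inner_n d (G x) (y - x) + \<mu> / 2 * (norm_n d (y - x))\<^sup>2"
      and lip: "\<And>x y. x \<in> Rn d \<Longrightarrow> y \<in> Rn d \<Longrightarrow> norm_n d (G x - G y) \<le> \<beta> * norm_n d (x - y)"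
      and ex1: "\<exists>!x. is_minimizer d f x" and ball: "minimizer d f \<in> cball_n d r"
      using f unfolding obj_class_def r_def by blast
    define u where "u = minimizer d f"
    have "is_minimizer d f u" unfolding u_def minimizer_def using ex1 by (rule theI')
    then have u: "u \<in> Rn d" "\<And>x. x \<in> Rn d \<Longrightarrow> f u \<le> f x"
      by (auto simp: is_minimizer_def is_arg_min_def not_less)
    have GR: "G x \<in> Rn d" if "x \<in> Rn d" for x using G[OF that] by (simp add: has_gradient_def)
    \<comment> \<open>\<open>agd_converges\<close> is applied with \<mu> / 2 for \<mu>, to match the
      weaker growth at the minimizer.\<close>
    have conv': "f y \<ge> f x + inner_n d (G x) (y - x) + \<mu> / 2 / 2 * (norm_n d (y - x))\<^sup>2"
      "f y \<ge> f x + inner_n d (G x) (y - x)" if "x \<in> Rn d" "y \<in> Rn d" for x y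
    proof -
      have "0 \<le> \<mu> / 2 / 2 * (norm_n d (y - x))\<^sup>2" using mu by simp
      with conv[OF that] show "f y \<ge> f x + inner_n d (G x) (y - x) + \<mu> / 2 / 2 * (norm_n d (y - x))\<^sup>2"
        "f y \<ge> f x + inner_n d (G x) (y - x)" by simp_all
    qed
    note smooth = smooth_upper_bound[of d f G \<beta>, OF conv'(2) lip]
    have growth: "f u + \<mu> / 2 / 2 * (norm_n d (x - u))\<^sup>2 \<le> f x" if "x \<in> Rn d" for x
      using quadratic_growth_at_minimizer[of d f G \<mu> u, OF conv u that] by simp
    define g where "g = grad_est d h (transcript_of q f T)"
    have err: "norm_n d (g s - G (agd_query d r \<beta> L g s)) \<le> e" if s: "s < Suc J * L" for s
    proof -
      have "agd_query d r \<beta> L g s \<in> Rn d"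
        using agd_query_in_cball[of r g d \<beta> L s] r grad_est_Rn by (simp add: cball_n_iff g_def)
      then have "norm_n d (g s - G (agd_query d r \<beta> L g s)) \<le> real d * (\<beta> * h)"
        using grad_est_transcript[OF s] grad_est_Rn unfolding g_def q_def T_def
        by (intro forward_difference_error[where f = f, OF GR conv'(2) smooth _ h(1)]) auto
      with he show ?thesis by linarith
    qed
    have step: "J = 0 \<or> 16 * \<beta> \<le> \<mu> / 2 * (real L)\<^sup>2"
    proof (cases "J = 0")
      case False
      then have "M = \<kappa>" using JM by blast
      then have "\<mu> / 2 * (36 * (\<beta> / \<mu>)) \<le> \<mu> / 2 * (real L)\<^sup>2"
        using L36 mu by (intro mult_left_mono) (auto simp: \<kappa>_def)
      then show ?thesis using mu \<beta> by simp
    qed simp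
    have "0 < \<mu> / 2" "0 \<le> r" "0 \<le> e" using mu r e by simp_all
    from agd_converges[where f = f and G = G, OF conv'(1) lip this(1) \<beta> this(2,3) L0 ball[folded u_def] growth grad_est_Rn[of d h "transcript_of q f T", folded g_def] err step]
    have "f (fst (agd d r \<beta> L g (Suc J * L))) - f u \<le> 16 * \<beta> * r\<^sup>2 / (real L)\<^sup>2 / 2 ^ J + 8 * r * e" .
    also have "16 * \<beta> * r\<^sup>2 / (real L)\<^sup>2 / 2 ^ J \<le> \<epsilon> / 2"
    proof -
      have "16 * \<beta> * r\<^sup>2 = 4 * (Q * \<epsilon>)" using eps by (simp add: r_def Q_def power_divide)
      also have "\<dots> \<le> 4 * (M * 2 ^ J * \<epsilon>)" using QM eps by simp
      also have "\<dots> \<le> \<epsilon> / 2 * (36 * M * 2 ^ J)" using eps M1 by simp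
      also have "\<dots> \<le> \<epsilon> / 2 * ((real L)\<^sup>2 * 2 ^ J)"
        using L36 eps by (intro mult_left_mono mult_right_mono) auto
      finally show ?thesis using L0 by (simp add: divide_le_eq mult_ac)
    qed
    also have "8 * r * e = \<epsilon> / 2" using R by (simp add: r_def e_def)
    finally have "f (fst (agd d r \<beta> L g (Suc J * L))) - f u \<le> \<epsilon>" by simp
    then show ?thesis by (simp add: alg_output_def qout_def g_def u_def)
  qed
  moreover have "real T \<le> 28 * real d * sqrt M * (1 + log_plus (Q / \<kappa>))"
  proof -
    have lp: "0 \<le> log_plus (Q / \<kappa>)" by (simp add: log_plus_def)
    have "real T = real (Suc J) * real L * real (Suc d)" by (simp only: T_def of_nat_mult)
    \<comment> \<open>Here 28 = 2 * 7 * 2: the periods (by ln 2 \<ge> 1/2), the rounding in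
      \<open>L\<close>, and d + 1 \<le> 2 d.\<close>
    also have "\<dots> \<le> (2 * (1 + log_plus (Q / \<kappa>))) * (7 * sqrt M) * (2 * real d)"
      using J_le L d lp sM by (intro mult_mono mult_nonneg_nonneg) auto
    finally show ?thesis by (simp add: mult_ac)
  qed
  ultimately show ?thesis unfolding M_def by blast
qed

section \<open>From query counts to the infimum over algorithms\<close>

lemma value_complexity_ge:
  assumes "\<And>T q qout. is_algorithm d R T q qout \<Longrightarrow>
    (\<And>f. f \<in> obj_class d R \<mu> \<beta> \<Longrightarrow> f (alg_output T q qout f) - f (minimizer d f) \<le> \<epsilon>) \<Longrightarrow> x \<le> real T"
  shows "ereal x \<le> ereal_of_enat (value_complexity \<epsilon> d R \<mu> \<beta>)"
proof -
  have "enat (nat \<lceil>x\<rceil>) \<le> value_complexity \<epsilon> d R \<mu> \<beta>"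
    unfolding value_complexity_def
  proof (rule Inf_greatest, clarify)
    fix T q qout
    assume alg: "is_algorithm d R T q qout"
      and "(SUP f\<in>obj_class d R \<mu> \<beta>. ereal (f (alg_output T q qout f) - f (minimizer d f))) \<le> ereal \<epsilon>"
    then have "f (alg_output T q qout f) - f (minimizer d f) \<le> \<epsilon>" if "f \<in> obj_class d R \<mu> \<beta>" for f
      using that by (auto simp: SUP_le_iff)
    then have "x \<le> real T" by (rule assms[OF alg])
    then show "enat (nat \<lceil>x\<rceil>) \<le> enat T" by (simp add: ceiling_le_iff nat_le_iff)
  qed
  then have "ereal_of_enat (enat (nat \<lceil>x\<rceil>)) \<le> ereal_of_enat (value_complexity \<epsilon> d R \<mu> \<beta>)"
    by (simp only: ereal_of_enat_le_iff)
  moreover have "ereal x \<le> ereal_of_enat (enat (nat \<lceil>x\<rceil>))" by (simp add: real_nat_ceiling_ge)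
  ultimately show ?thesis by (rule order_trans[rotated])
qed

lemma value_complexity_le:
  assumes "is_algorithm d R T q qout"
    "\<And>f. f \<in> obj_class d R \<mu> \<beta> \<Longrightarrow> f (alg_output T q qout f) - f (minimizer d f) \<le> \<epsilon>"
  shows "ereal_of_enat (value_complexity \<epsilon> d R \<mu> \<beta>) \<le> ereal (real T)"
proof -
  have "value_complexity \<epsilon> d R \<mu> \<beta> \<le> enat T"
    unfolding value_complexity_def using assms
    by (intro Inf_lower CollectI exI[of _ T] exI[of _ q] exI[of _ qout] conjI refl) (auto intro: SUP_least)
  then have "ereal_of_enat (value_complexity \<epsilon> d R \<mu> \<beta>) \<le> ereal_of_enat (enat T)"
    by (simp only: ereal_of_enat_le_iff)
  then show ?thesis by simp
qed

theorem theorem3p7: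
  "\<exists>c>0. \<exists>C>0. \<exists>c\<^sub>\<epsilon>>0. \<exists>d\<^sub>0::nat.
     \<forall>(d::nat) (R::real) (\<mu>::real) (\<beta>::real) (\<epsilon>::real).
       d \<ge> d\<^sub>0 \<longrightarrow> R > 0 \<longrightarrow> 0 < \<mu> \<longrightarrow> \<mu> \<le> \<beta> \<longrightarrow> 0 < \<epsilon> \<longrightarrow> \<epsilon> \<le> c\<^sub>\<epsilon> * \<beta> * R\<^sup>2 \<longrightarrow>
       (let Q = \<beta> * R\<^sup>2 / \<epsilon>; \<kappa> = \<beta> / \<mu> in
         min Q \<kappa> \<le> (real d / ln (exp 1 * real d)) powr (2 / 3) \<longrightarrow>
         ereal (c * real d * sqrt (min Q \<kappa>)) \<le> ereal_of_enat (value_complexity \<epsilon> d R \<mu> \<beta>) \<and>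
         ereal_of_enat (value_complexity \<epsilon> d R \<mu> \<beta>)
           \<le> ereal (C * real d * sqrt (min Q \<kappa>) * (1 + log_plus (Q / \<kappa>))))"
proof (rule exI[of _ "1 / 6528"], intro conjI, simp, rule exI[of _ 28], intro conjI, simp,
    rule exI[of _ "1 / 257"], intro conjI, simp, rule exI[of _ "2 ^ 26"], unfold Let_def, intro allI impI)
  fix d :: nat and R \<mu> \<beta> \<epsilon> :: real
  assume d: "2 ^ 26 \<le> d" and R: "R > 0" and mu: "0 < \<mu>" "\<mu> \<le> \<beta>" and eps: "0 < \<epsilon>" "\<epsilon> \<le> 1 / 257 * \<beta> * R\<^sup>2"
    and small: "min (\<beta> * R\<^sup>2 / \<epsilon>) (\<beta> / \<mu>) \<le> (real d / ln (exp 1 * real d)) powr (2 / 3)"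
  have eps': "257 * \<epsilon> \<le> \<beta> * R\<^sup>2" using eps by simp
  have d1: "1 \<le> d" using d by simp
  have "\<epsilon> \<le> \<beta> * R\<^sup>2" using eps eps' by linarith
  from query_count_upper[OF d1 R mu eps(1) this]
  obtain T q qout where "is_algorithm d R T q qout"
    "\<And>f. f \<in> obj_class d R \<mu> \<beta> \<Longrightarrow> f (alg_output T q qout f) - f (minimizer d f) \<le> \<epsilon>"
    and T: "real T \<le> 28 * real d * sqrt (min (\<beta> * R\<^sup>2 / \<epsilon>) (\<beta> / \<mu>)) * (1 + log_plus (\<beta> * R\<^sup>2 / \<epsilon> / (\<beta> / \<mu>)))"
    by blast
  then have "ereal_of_enat (value_complexity \<epsilon> d R \<mu> \<beta>) \<le> ereal (real T)" by (intro value_complexity_le)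
  also have "ereal (real T) \<le> ereal (28 * real d * sqrt (min (\<beta> * R\<^sup>2 / \<epsilon>) (\<beta> / \<mu>)) * (1 + log_plus (\<beta> * R\<^sup>2 / \<epsilon> / (\<beta> / \<mu>))))"
    using T by (simp only: ereal_less_eq)
  finally have upper: "ereal_of_enat (value_complexity \<epsilon> d R \<mu> \<beta>) \<le> \<dots>" .
  have "ereal (1 / 6528 * real d * sqrt (min (\<beta> * R\<^sup>2 / \<epsilon>) (\<beta> / \<mu>))) \<le> ereal_of_enat (value_complexity \<epsilon> d R \<mu> \<beta>)"
    by (rule value_complexity_ge) (rule query_count_lower[OF d R mu eps(1) eps' small])
  from this upper show "ereal (1 / 6528 * real d * sqrt (min (\<beta> * R\<^sup>2 / \<epsilon>) (\<beta> / \<mu>))) \<le> ereal_of_enat (value_complexity \<epsilon> d R \<mu> \<beta>) \<and>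
    ereal_of_enat (value_complexity \<epsilon> d R \<mu> \<beta>) \<le> ereal (28 * real d * sqrt (min (\<beta> * R\<^sup>2 / \<epsilon>) (\<beta> / \<mu>)) * (1 + log_plus (\<beta> * R\<^sup>2 / \<epsilon> / (\<beta> / \<mu>))))" ..
qed

end
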